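(* Let $F\colon\mathcal H\to\mathcal K$ be a frame, let $H_0$ be a self-adjoint operator on $\mathcal H$, let $V\in\mathcal A(F)$, and let $H_s=H_0+sV$. Let $z\in\mathbb C\setminus\mathbb R$. If $s_0$ is a (necessarily non-real) pole of the meromorphic function $$\mathbb C\ni s\mapsto F_z(s)=\mathrm{Tr}\Big(\frac1\pi\mathrm{Im}\,R_z(H_s)V\Big),$$ then $$2\pi i\,\mathrm{res}_{s=s_0}F_z(s)=N_+-N_-,$$ where $N_+$ (respectively, $N_-$) is the multiplicity of $-s_0^{-1}$ as an eigenvalue of $R_z(H_0)V$ (respectively, of $R_{\bar z}(H_0)V$).
   Context: $\mathcal H$ is a complex separable Hilbert space. A frame is a Hilbert–Schmidt operator $F\colon\mathcal H\to\mathcal K$ into another Hilbert space with trivial kernel and co-kernel. $\mathcal A(F)=\{F^*JF: J \text{ bounded self-adjoint on }\mathcal K\}$ (so $V$ is self-adjoint and trace class). $R_z(H)=(H-z)^{-1}$, $\mathrm{Im}\,A=(A-A^* )/(2i)$. $F_z(s)$ is defined for real $s$ by the formula and for complex $s$ denotes its meromorphic continuation to $\mathbb C$. Multiplicities of eigenvalues are algebraic, and the multiplicity is $0$ if the number is not an eigenvalue. *)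

theory Defs
  imports "HOL-Complex_Analysis.Complex_Analysis"
begin

section \<open>Complex Hilbert spaces\<close>

text \<open>
  A complex Hilbert space is presented as a complete real inner product space together with a
  complex scalar multiplication extending the real one and a sesquilinear form, conjugate-linear
  in the first and linear in the second argument, whose real part is the given real inner product.
  Positive definiteness and \<open>\<parallel>x\<parallel>\<^sup>2 = \<langle>x, x\<rangle>\<close> are inherited from \<^class>\<open>real_inner\<close>.
\<close>

class chilbert_space = real_inner + complete_space +
  fixes scaleC :: "complex \<Rightarrow> 'a \<Rightarrow> 'a" (infixr "*\<^sub>C" 75)
    and cinner :: "'a \<Rightarrow> 'a \<Rightarrow> complex"
  assumes scaleC_add_right: "a *\<^sub>C (x + y) = a *\<^sub>C x + a *\<^sub>C y"
    and scaleC_add_left: "(a + b) *\<^sub>C x = a *\<^sub>C x + b *\<^sub>C x"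
    and scaleC_scaleC: "a *\<^sub>C b *\<^sub>C x = (a * b) *\<^sub>C x"
    and scaleC_of_real: "complex_of_real r *\<^sub>C x = r *\<^sub>R x"
    and cinner_commute: "cinner x y = cnj (cinner y x)"
    and cinner_add_right: "cinner x (y + z) = cinner x y + cinner x z"
    and cinner_scaleC_right: "cinner x (a *\<^sub>C y) = a * cinner x y"
    and Re_cinner: "Re (cinner x y) = inner x y"

lemma scaleC_one: "1 *\<^sub>C x = (x :: 'a :: chilbert_space)"
  using scaleC_of_real[of 1 x] by simp

global_interpretation complex_vector:
  vector_space "scaleC :: complex \<Rightarrow> 'a \<Rightarrow> 'a :: chilbert_space"
  defines csubspace = complex_vector.subspace
    and cspan = complex_vector.span
    and cdependent = complex_vector.dependent
    and crepresentation = complex_vector.representation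
    and cextend_basis = complex_vector.extend_basis
    and cdim = complex_vector.dim
  by unfold_locales (simp_all add: scaleC_add_right scaleC_add_left scaleC_scaleC scaleC_one)

instantiation complex :: chilbert_space
begin

definition scaleC_complex :: "complex \<Rightarrow> complex \<Rightarrow> complex"
  where "scaleC_complex a x = a * x"

definition cinner_complex :: "complex \<Rightarrow> complex \<Rightarrow> complex"
  where "cinner_complex x y = cnj x * y"

instance
  by standard
    (simp_all add: scaleC_complex_def cinner_complex_def inner_complex_def algebra_simps
      scaleR_conv_of_real)

end

definition is_onb :: "'a :: chilbert_space set \<Rightarrow> bool"
  where "is_onb B \<longleftrightarrow>
    (\<forall>e\<in>B. norm e = 1) \<and> pairwise (\<lambda>x y. cinner x y = 0) B \<and> closure (cspan B) = UNIV"


section \<open>Bounded operators\<close>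

definition bounded_clinear :: "('a :: chilbert_space \<Rightarrow> 'b :: chilbert_space) \<Rightarrow> bool"
  where "bounded_clinear A \<longleftrightarrow> bounded_linear A \<and> (\<forall>c x. A (c *\<^sub>C x) = c *\<^sub>C A x)"

text \<open>The Hilbert space adjoint, meaningful for bounded operators.\<close>

definition cadjoint :: "('a :: chilbert_space \<Rightarrow> 'b :: chilbert_space) \<Rightarrow> 'b \<Rightarrow> 'a"
  where "cadjoint A = (THE B. \<forall>x y. cinner (B y) x = cinner y (A x))"

definition bounded_selfadjoint :: "('a :: chilbert_space \<Rightarrow> 'a) \<Rightarrow> bool"
  where "bounded_selfadjoint J \<longleftrightarrow> bounded_clinear J \<and> cadjoint J = J"

definition Im_op :: "('a :: chilbert_space \<Rightarrow> 'a) \<Rightarrow> 'a \<Rightarrow> 'a"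
  where "Im_op A = (\<lambda>x. (1 / (2 * \<i>)) *\<^sub>C (A x - cadjoint A x))"

definition hilbert_schmidt :: "('a :: chilbert_space \<Rightarrow> 'b :: chilbert_space) \<Rightarrow> bool"
  where "hilbert_schmidt A \<longleftrightarrow>
    bounded_clinear A \<and> (\<exists>B. is_onb B \<and> (\<lambda>e. (norm (A e))\<^sup>2) summable_on B)"

text \<open>
  The trace, computed in some orthonormal basis; for trace class operators the sum converges
  absolutely and does not depend on the basis.
\<close>

definition trace_op :: "('a :: chilbert_space \<Rightarrow> 'a) \<Rightarrow> complex"
  where "trace_op A = (\<Sum>\<^sub>\<infinity>e\<in>(SOME B. is_onb B). cinner e (A e))"

text \<open>
  The algebraic multiplicity of \<open>\<mu>\<close> is the complex dimension of the root space
  \<open>\<Union>n. ker (A - \<mu>)\<^sup>n\<close>; it is \<open>0\<close> if \<open>\<mu>\<close> is not an eigenvalue.  Note that \<^const>\<open>cdim\<close>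
  is also \<open>0\<close> in infinite dimension, which does not happen for compact \<open>A\<close> and \<open>\<mu> \<noteq> 0\<close>.
\<close>

definition algebraic_multiplicity :: "('a :: chilbert_space \<Rightarrow> 'a) \<Rightarrow> complex \<Rightarrow> nat"
  where "algebraic_multiplicity A \<mu> =
    cdim (\<Union>n. {x. ((\<lambda>y. A y - \<mu> *\<^sub>C y) ^^ n) x = 0})"


section \<open>Unbounded self-adjoint operators and resolvents\<close>

text \<open>
  An unbounded operator is given by its domain \<open>D\<close> and a function \<open>H\<close>, of which only the values
  on \<open>D\<close> matter.  Self-adjointness is equality of the graphs of the operator and of its adjoint.
\<close>

definition adjoint_graph :: "'a :: chilbert_space set \<Rightarrow> ('a \<Rightarrow> 'a) \<Rightarrow> ('a \<times> 'a) set"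
  where "adjoint_graph D H = {(y, w). \<forall>x\<in>D. cinner y (H x) = cinner w x}"

definition selfadjoint_on :: "'a :: chilbert_space set \<Rightarrow> ('a \<Rightarrow> 'a) \<Rightarrow> bool"
  where "selfadjoint_on D H \<longleftrightarrow>
    csubspace D \<and> closure D = UNIV \<and>
    (\<forall>x\<in>D. \<forall>y\<in>D. H (x + y) = H x + H y) \<and> (\<forall>c. \<forall>x\<in>D. H (c *\<^sub>C x) = c *\<^sub>C H x) \<and>
    adjoint_graph D H = (\<lambda>x. (x, H x)) ` D"

text \<open>\<open>R\<^sub>z(H) = (H - z)\<^sup>-\<^sup>1\<close>, meaningful for \<open>z\<close> in the resolvent set of \<open>H\<close>.\<close>

definition resolvent :: "'a :: chilbert_space set \<Rightarrow> ('a \<Rightarrow> 'a) \<Rightarrow> complex \<Rightarrow> 'a \<Rightarrow> 'a"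
  where "resolvent D H z = inv_into D (\<lambda>x. H x - z *\<^sub>C x)"


section \<open>Frames and the function \<open>F\<^sub>z\<close>\<close>

text \<open>
  The co-kernel is the orthogonal complement of the range, that is, the kernel of the adjoint.
\<close>

definition frame :: "('a :: chilbert_space \<Rightarrow> 'b :: chilbert_space) \<Rightarrow> bool"
  where "frame F \<longleftrightarrow>
    hilbert_schmidt F \<and> {x. F x = 0} = {0} \<and> {y. cadjoint F y = 0} = {0}"

definition frame_perturbations ::
    "('a :: chilbert_space \<Rightarrow> 'b :: chilbert_space) \<Rightarrow> ('a \<Rightarrow> 'a) set"
  where "frame_perturbations F = {cadjoint F \<circ> J \<circ> F | J. bounded_selfadjoint J}"

text \<open>
  The meromorphic continuation to the whole plane of a function on the real line.  It is unique
  as a function because \<^term>\<open>G nicely_meromorphic_on UNIV\<close> includes the conventions that \<open>G\<close>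
  is continuous away from its poles and has the value \<open>0\<close> at its poles.
\<close>

definition meromorphic_continuation :: "(real \<Rightarrow> complex) \<Rightarrow> complex \<Rightarrow> complex"
  where "meromorphic_continuation f =
    (THE G. G nicely_meromorphic_on UNIV \<and> (\<forall>s. G (complex_of_real s) = f s))"

text \<open>
  The operator \<open>H\<^sub>s = H\<^sub>0 + sV\<close> has the same domain \<open>D\<close> as \<open>H\<^sub>0\<close> since \<open>V\<close> is bounded.
\<close>

definition F_real ::
    "'a :: chilbert_space set \<Rightarrow> ('a \<Rightarrow> 'a) \<Rightarrow> ('a \<Rightarrow> 'a) \<Rightarrow> complex \<Rightarrow> real \<Rightarrow> complex"
  where "F_real D H\<^sub>0 V z s =
    trace_op (\<lambda>x. complex_of_real (1 / pi) *\<^sub>C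
      Im_op (resolvent D (\<lambda>y. H\<^sub>0 y + s *\<^sub>R V y) z) (V x))"

definition F_fun ::
    "'a :: chilbert_space set \<Rightarrow> ('a \<Rightarrow> 'a) \<Rightarrow> ('a \<Rightarrow> 'a) \<Rightarrow> complex \<Rightarrow> complex \<Rightarrow> complex"
  where "F_fun D H\<^sub>0 V z = meromorphic_continuation (F_real D H\<^sub>0 V z)"

end

theory Submission
  imports Defs
begin

text \<open>
  Put \<open>A = R\<^sub>z(H\<^sub>0) V\<close> and let \<open>B\<close> be the same operator for the conjugate of \<open>z\<close>. The adjoint of
  \<open>R\<^sub>z(H\<^sub>s)\<close> is the resolvent at the conjugate point, and
  \<open>R\<^sub>z(H\<^sub>s) V = (1 + sA)\<^sup>-\<^sup>1 A\<close> by the second resolvent identity, so for real \<open>s\<close>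
  \<open>2 \<pi> \<i> F\<^sub>z(s) = g\<^sub>A(s) - g\<^sub>B(s)\<close> with \<open>g\<^sub>A(s) = Tr((1 + sA)\<^sup>-\<^sup>1 A)\<close>.
  Formally \<open>g\<^sub>A\<close> is the logarithmic derivative of the Fredholm determinant \<open>det(1 + sA)\<close>, which
  vanishes at \<open>s\<^sub>0\<close> to the order of the algebraic multiplicity \<open>m\<close> of the eigenvalue
  \<open>\<mu> = -1/s\<^sub>0\<close> of \<open>A\<close>. What has to be shown is therefore that \<open>g\<^sub>A(s) - m / (s - s\<^sub>0)\<close> is
  holomorphic near \<open>s\<^sub>0\<close>; this is done without determinants.

  Let \<open>N\<close> be the root space of \<open>A\<close> for \<open>\<mu>\<close>. It has an orthonormal basis in which \<open>A\<close> is
  triangular with \<open>\<mu>\<close> on the diagonal. For any such orthonormal system of length \<open>d\<close> the diagonal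
  entries add up to \<open>d \<bar>\<mu>\<bar>\<close> in absolute value, and this is bounded by the trace norm of \<open>A\<close>, so
  that a longest system exists; maximality makes it span \<open>N\<close> (\<open>root_space_triangular_basis\<close>).
  Let \<open>Q\<close> be the orthogonal projection onto \<open>N\<close> and \<open>A\<^sub>2 = (1 - Q) A\<close>. Since \<open>N\<close> is
  \<open>A\<close>-invariant, \<open>1 + sA\<close> is block triangular for \<open>N\<close> and its orthogonal complement, hence
  \<open>(1 - Q)(1 + sA)\<^sup>-\<^sup>1 A = (1 + sA\<^sub>2)\<^sup>-\<^sup>1 A\<^sub>2\<close>. The \<open>N\<close> block contributes
  \<open>d \<mu> / (1 + s\<mu>) = d / (s - s\<^sub>0)\<close> to the trace. A vector in the kernel of \<open>1 + s\<^sub>0 A\<^sub>2\<close> is orthogonal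
  to \<open>N\<close> and is mapped into \<open>N\<close> by \<open>A - \<mu>\<close>, so it lies in \<open>N\<close> and is \<open>0\<close>. By the Fredholm alternative
  \<open>1 + s\<^sub>0 A\<^sub>2\<close> is boundedly invertible, and the other block contributes a holomorphic function
  (\<open>fredholm_trace_polar_part\<close>).

  The operator \<open>V = F\<^sup>* J F\<close> supports this argument because it is a norm limit of operators of
  finite rank (\<open>finite_rank_limit\<close>), and \<open>\<Sum>\<bar>\<langle>e, X V e\<rangle>\<bar>\<close> over any orthonormal set is at most
  a constant times the norm of \<open>X\<close> (\<open>trace_bounded\<close>). Both follow from \<open>F\<close> being
  Hilbert--Schmidt.
\<close>

section \<open>Complex inner products and bounded operators\<close>

lemma cinner_add_left: "cinner (x + y) z = cinner x z + cinner y z"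
  by (metis cinner_add_right cinner_commute complex_cnj_add)

lemma cinner_scaleC_left: "cinner (a *\<^sub>C x) y = cnj a * cinner x y"
  by (metis cinner_commute cinner_scaleC_right complex_cnj_mult)

lemma cinner_zero_right [simp]: "cinner x 0 = 0"
  using cinner_add_right[of x 0 0] by simp

lemma cinner_zero_left [simp]: "cinner 0 x = 0"
  using cinner_add_left[of 0 0 x] by simp

lemma cinner_minus_right: "cinner x (- y) = - cinner x y"
  using cinner_add_right[of x y "- y"] by (simp add: eq_neg_iff_add_eq_0 add.commute)

lemma cinner_diff_right: "cinner x (y - z) = cinner x y - cinner x z"
  using cinner_add_right[of x y "- z"] cinner_minus_right[of x z] by simp

lemma cinner_diff_left: "cinner (x - y) z = cinner x z - cinner y z"
  by (metis cinner_commute cinner_diff_right complex_cnj_diff)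

lemma cinner_sum_right: "cinner x (\<Sum>i\<in>I. f i) = (\<Sum>i\<in>I. cinner x (f i))"
  by (induction I rule: infinite_finite_induct) (auto simp: cinner_add_right)

lemma cinner_sum_left: "cinner (\<Sum>i\<in>I. f i) x = (\<Sum>i\<in>I. cinner (f i) x)"
  by (induction I rule: infinite_finite_induct) (auto simp: cinner_add_left)

lemma cinner_self: "cinner x x = complex_of_real ((norm x)\<^sup>2)"
proof (rule complex_eqI)
  show "Re (cinner x x) = Re (complex_of_real ((norm x)\<^sup>2))"
    by (simp add: Re_cinner power2_norm_eq_inner)
  have "Im (cinner x x) = Im (cnj (cinner x x))"
    using cinner_commute[of x x] by simp
  then show "Im (cinner x x) = Im (complex_of_real ((norm x)\<^sup>2))"
    by simp
qed

lemma cinner_self_eq_0: "cinner x x = 0 \<longleftrightarrow> x = 0"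
  by (simp add: cinner_self)

lemma cinner_eqI:
  assumes "\<And>x. cinner u x = cinner v x"
  shows "u = v"
  using assms[of "u - v"] by (metis cinner_diff_left cinner_self_eq_0 eq_iff_diff_eq_0)

lemma norm_scaleC: "norm (a *\<^sub>C x) = cmod a * norm x"
proof -
  have "cnj a * a = complex_of_real ((cmod a)\<^sup>2)"
    by (metis complex_norm_square mult.commute)
  then have "cinner (a *\<^sub>C x) (a *\<^sub>C x) = complex_of_real ((cmod a)\<^sup>2) * complex_of_real ((norm x)\<^sup>2)"
    by (metis cinner_scaleC_left cinner_scaleC_right cinner_self mult.assoc)
  then have "complex_of_real ((norm (a *\<^sub>C x))\<^sup>2) = complex_of_real ((cmod a * norm x)\<^sup>2)"
    by (metis cinner_self of_real_mult power_mult_distrib)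
  then have "(norm (a *\<^sub>C x))\<^sup>2 = (cmod a * norm x)\<^sup>2"
    by (rule of_real_eq_iff[THEN iffD1])
  then show ?thesis by (simp add: power2_eq_iff_nonneg)
qed

lemma cmod_cinner_le: "cmod (cinner x y) \<le> norm x * norm y"
proof (cases "cinner x y = 0")
  case False
  define c where "c = cinner x y"
  \<comment> \<open>rotate \<open>y\<close> by a phase that makes the inner product real and positive\<close>
  define u where "u = cnj c / complex_of_real (cmod c)"
  have "u * c = complex_of_real (cmod c)"
    using False by (simp add: u_def c_def complex_norm_square[symmetric] power2_eq_square mult.commute)
  then have "cmod c = Re (cinner x (u *\<^sub>C y))"
    by (simp add: cinner_scaleC_right c_def)
  also have "\<dots> \<le> norm x * norm (u *\<^sub>C y)"
    by (simp add: Re_cinner norm_cauchy_schwarz)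
  also have "norm (u *\<^sub>C y) = norm y"
    using False by (simp add: norm_scaleC u_def c_def norm_divide)
  finally show ?thesis by (simp add: c_def)
qed (simp add: mult_nonneg_nonneg)

lemma norm_add_orthogonal:
  assumes "cinner x y = 0"
  shows "(norm (x + y))\<^sup>2 = (norm x)\<^sup>2 + (norm y)\<^sup>2"
proof -
  have "inner x y = 0" using assms by (metis Re_cinner zero_complex.simps(1))
  then show ?thesis by (simp add: power2_norm_eq_inner inner_add_left inner_add_right inner_commute)
qed

lemma scaleC_complex_eq: "(a :: complex) *\<^sub>C b = a * b"
  by (simp add: scaleC_complex_def)

lemma bounded_clinearI:
  assumes "\<And>x y. A (x + y) = A x + A y" "\<And>c x. A (c *\<^sub>C x) = c *\<^sub>C A x"
    and "\<And>x. norm (A x) \<le> norm x * K"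
  shows "bounded_clinear A"
  unfolding bounded_clinear_def
proof
  show "bounded_linear A"
    by (rule bounded_linear_intro[of _ K]) (use assms in \<open>simp_all add: scaleC_of_real[symmetric]\<close>)
qed (use assms in simp)

lemma bounded_clinear_imp_bounded_linear: "bounded_clinear A \<Longrightarrow> bounded_linear A"
  by (simp add: bounded_clinear_def)

lemma bounded_clinear_scaleC: "bounded_clinear A \<Longrightarrow> A (c *\<^sub>C x) = c *\<^sub>C A x"
  by (simp add: bounded_clinear_def)

lemma
  assumes "bounded_clinear A"
  shows bounded_clinear_add: "A (x + y) = A x + A y"
    and bounded_clinear_diff: "A (x - y) = A x - A y"
    and bounded_clinear_zero: "A 0 = 0"
    and bounded_clinear_sum: "A (\<Sum>i\<in>I. f i) = (\<Sum>i\<in>I. A (f i))"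
    and bounded_clinear_norm_le: "norm (A x) \<le> onorm A * norm x"
    and bounded_clinear_onorm_nonneg: "0 \<le> onorm A"
proof -
  interpret bounded_linear A using assms by (rule bounded_clinear_imp_bounded_linear)
  show "A (x + y) = A x + A y" "A (x - y) = A x - A y" "A 0 = 0" "A (\<Sum>i\<in>I. f i) = (\<Sum>i\<in>I. A (f i))"
    by (rule add diff zero sum)+
  show "norm (A x) \<le> onorm A * norm x" by (rule onorm) (rule bounded_linear_axioms)
  show "0 \<le> onorm A" by (rule onorm_pos_le) (rule bounded_linear_axioms)
qed

lemma bounded_clinear_id: "bounded_clinear (\<lambda>x. x)"
  by (rule bounded_clinearI[of _ 1]) simp_all

lemma bounded_clinear_compose:
  assumes "bounded_clinear A" "bounded_clinear B"
  shows "bounded_clinear (\<lambda>x. A (B x))"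
  using assms bounded_linear_compose unfolding bounded_clinear_def by auto

lemma bounded_clinear_plus:
  assumes "bounded_clinear A" "bounded_clinear B"
  shows "bounded_clinear (\<lambda>x. A x + B x)"
  using assms bounded_linear_add unfolding bounded_clinear_def by (auto simp: scaleC_add_right)

lemma bounded_clinear_minus:
  assumes "bounded_clinear A" "bounded_clinear B"
  shows "bounded_clinear (\<lambda>x. A x - B x)"
  using assms bounded_linear_sub unfolding bounded_clinear_def
  by (auto simp: complex_vector.scale_right_diff_distrib)

lemma bounded_clinear_scaleC_fun:
  assumes "bounded_clinear A"
  shows "bounded_clinear (\<lambda>x. c *\<^sub>C A x)"
proof (rule bounded_clinearI[of _ "cmod c * onorm A"])
  show "norm (c *\<^sub>C A x) \<le> norm x * (cmod c * onorm A)" for x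
    using mult_left_mono[OF bounded_clinear_norm_le[OF assms, of x] norm_ge_zero[of c]]
    by (simp add: norm_scaleC mult_ac)
qed (simp_all add: bounded_clinear_add[OF assms] bounded_clinear_scaleC[OF assms]
    scaleC_add_right scaleC_scaleC mult.commute)

lemma bounded_clinear_cinner: "bounded_clinear (cinner e)"
  by (rule bounded_clinearI[of _ "norm e"])
     (simp_all add: cinner_add_right cinner_scaleC_right scaleC_complex_eq cmod_cinner_le mult.commute[of "norm _" "norm e"])

lemma bounded_clinear_cinner_scaleC: "bounded_clinear (\<lambda>x. cinner e x *\<^sub>C v)"
proof (rule bounded_clinearI[of _ "norm e * norm v"])
  show "norm (cinner e x *\<^sub>C v) \<le> norm x * (norm e * norm v)" for x
    using mult_right_mono[OF cmod_cinner_le[of e x] norm_ge_zero[of v]]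
    by (simp add: norm_scaleC mult_ac)
qed (simp_all add: cinner_add_right scaleC_add_left cinner_scaleC_right scaleC_scaleC)

lemma bounded_clinear_finite_sum:
  assumes "\<And>i. i \<in> I \<Longrightarrow> bounded_clinear (A i)"
  shows "bounded_clinear (\<lambda>x. \<Sum>i\<in>I. A i x)"
  using assms
proof (induction I rule: infinite_finite_induct)
  case (insert i I)
  then show ?case by (simp add: bounded_clinear_plus)
qed (auto intro: bounded_clinearI[of _ 0])

lemma onorm_compose_le:
  assumes "bounded_clinear A" "bounded_clinear B"
  shows "onorm (\<lambda>x. A (B x)) \<le> onorm A * onorm B"
  using onorm_compose[of A B] assms by (simp add: bounded_clinear_def comp_def)

lemma inj_bounded_clinear_iff:
  assumes "bounded_clinear A"
  shows "inj A \<longleftrightarrow> (\<forall>x. A x = 0 \<longrightarrow> x = 0)"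
  using assms by (simp add: bounded_clinear_def bounded_linear.linear linear_injective_0)

section \<open>Minimal vectors, Riesz representation and adjoints\<close>

text \<open>
  Completeness enters through nested closed sets: by the parallelogram law the sets of
  almost minimal vectors in \<open>C\<close> have diameter tending to \<open>0\<close>.
\<close>

lemma exists_minimal_norm:
  fixes C :: "'a :: {real_inner, complete_space} set"
  assumes "closed C" "convex C" "C \<noteq> {}"
  shows "\<exists>x\<in>C. \<forall>y\<in>C. norm x \<le> norm y"
proof -
  define d where "d = Inf ((\<lambda>x. (norm x)\<^sup>2) ` C)"
  have bdd: "bdd_below ((\<lambda>x. (norm x)\<^sup>2) ` C)" by (rule bdd_belowI[of _ 0]) auto
  have d_le: "d \<le> (norm y)\<^sup>2" if "y \<in> C" for y
    unfolding d_def by (rule cInf_lower) (use that bdd in auto)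
  define S where "S n = {x\<in>C. (norm x)\<^sup>2 \<le> d + inverse (real (Suc n))}" for n
  have "closed (S n)" for n
  proof -
    have "S n = C \<inter> {x. (norm x)\<^sup>2 \<le> d + inverse (real (Suc n))}" by (auto simp: S_def)
    then show ?thesis using assms(1) by (auto intro!: closed_Int closed_Collect_le continuous_intros)
  qed
  moreover have "S n \<noteq> {}" for n
  proof -
    have "\<exists>v\<in>(\<lambda>x. (norm x)\<^sup>2) ` C. v < d + inverse (real (Suc n))"
      unfolding d_def by (rule cInf_lessD) (use assms(3) in auto)
    then show ?thesis by (force simp: S_def)
  qed
  moreover have "S n \<subseteq> S m" if "m \<le> n" for m n
  proof -
    have "inverse (real (Suc n)) \<le> inverse (real (Suc m))"
      using that by (intro le_imp_inverse_le) auto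
    then show ?thesis unfolding S_def by (smt (verit) Collect_mono)
  qed
  moreover have "\<exists>n. \<forall>x\<in>S n. \<forall>y\<in>S n. dist x y < e" if "0 < e" for e
  proof -
    obtain n where n: "inverse (real (Suc n)) < e\<^sup>2 / 4"
      using reals_Archimedean[of "e\<^sup>2 / 4"] \<open>0 < e\<close> by auto
    have "dist x y < e" if "x \<in> S n" "y \<in> S n" for x y
    proof -
      have "(1/2) *\<^sub>R x + (1/2) *\<^sub>R y \<in> C"
        using that assms(2) by (intro convexD) (auto simp: S_def)
      then have "d \<le> (norm ((1/2) *\<^sub>R x + (1/2) *\<^sub>R y))\<^sup>2" by (rule d_le)
      moreover have "(dist x y)\<^sup>2 = 2 * (norm x)\<^sup>2 + 2 * (norm y)\<^sup>2
          - 4 * (norm ((1/2) *\<^sub>R x + (1/2) *\<^sub>R y))\<^sup>2"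
        by (simp add: dist_norm power2_norm_eq_inner inner_diff_left inner_diff_right
            inner_add_left inner_add_right inner_commute algebra_simps)
      ultimately have "(dist x y)\<^sup>2 \<le> 4 * inverse (real (Suc n))"
        using that by (simp add: S_def)
      also have "\<dots> < e\<^sup>2" using n by simp
      finally show ?thesis by (rule power2_less_imp_less) (use \<open>0 < e\<close> in simp)
    qed
    then show ?thesis by blast
  qed
  ultimately obtain a where a: "\<And>n. a \<in> S n"
    using decreasing_closed_nest[of S] by blast
  have "(norm a)\<^sup>2 \<le> d"
  proof (rule field_le_epsilon)
    fix e :: real assume "0 < e"
    then obtain n where "inverse (real (Suc n)) < e" using reals_Archimedean by blast
    then show "(norm a)\<^sup>2 \<le> d + e" using a[of n] by (simp add: S_def)
  qed
  then have "norm a \<le> norm y" if "y \<in> C" for y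
    using power2_le_imp_le[OF order_trans[OF _ d_le[OF that]]] by simp
  then show ?thesis using a by (auto simp: S_def)
qed

lemma minimal_norm_orthogonal:
  assumes "\<And>c. norm x \<le> norm (x + c *\<^sub>C k)"
  shows "cinner k x = 0"
proof (cases "k = 0")
  case False
  define t where "t = - cinner k x / cinner k k"
  have kk: "cinner k k \<noteq> 0" using False by (simp add: cinner_self_eq_0)
  have "cinner (x + t *\<^sub>C k) (- t *\<^sub>C k) = 0"
  proof -
    have "cinner k (x + t *\<^sub>C k) = 0"
      using kk by (simp add: cinner_diff_right cinner_add_right cinner_scaleC_right t_def)
    then have "cinner (x + t *\<^sub>C k) k = 0" by (metis cinner_commute complex_cnj_zero)
    then show ?thesis by (simp add: cinner_scaleC_right cinner_minus_right)
  qed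
  from norm_add_orthogonal[OF this]
  have "(norm x)\<^sup>2 = (norm (x + t *\<^sub>C k))\<^sup>2 + (norm (- t *\<^sub>C k))\<^sup>2" by simp
  moreover have "(norm x)\<^sup>2 \<le> (norm (x + t *\<^sub>C k))\<^sup>2" using assms by (simp add: power_mono)
  ultimately have "norm (- t *\<^sub>C k) = 0" by (smt (verit) zero_le_power2 power2_eq_iff_nonneg power_zero_numeral norm_ge_zero)
  then have "t = 0" using False by (simp add: norm_scaleC)
  then show ?thesis using kk by (simp add: t_def)
qed simp

lemma csubspace_imp_convex: "csubspace M \<Longrightarrow> convex M"
  unfolding convex_def by (metis complex_vector.subspace_add complex_vector.subspace_scale scaleC_of_real)

text \<open>
  Used to show that \<open>H - z\<close> is onto. For \<open>x\<close> arbitrary, the shortest vector of \<open>x + M\<close>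
  is orthogonal to \<open>M\<close>.
\<close>

lemma closed_csubspace_eq_UNIV:
  fixes M :: "'a :: chilbert_space set"
  assumes "csubspace M" "closed M" and orth: "\<And>y. (\<And>k. k \<in> M \<Longrightarrow> cinner k y = 0) \<Longrightarrow> y = 0"
  shows "M = UNIV"
proof -
  have "x \<in> M" for x
  proof -
    let ?C = "(+) x ` M"
    have "closed ?C" "convex ?C" "?C \<noteq> {}"
      using assms csubspace_imp_convex complex_vector.subspace_0[of M]
      by (auto intro: closed_translation convex_translation)
    from exists_minimal_norm[OF this]
    obtain m where m: "m \<in> M" and min: "\<And>k. k \<in> M \<Longrightarrow> norm (x + m) \<le> norm (x + k)"
      by auto
    have "cinner k (x + m) = 0" if "k \<in> M" for k
    proof (rule minimal_norm_orthogonal)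
      fix c
      have "m + c *\<^sub>C k \<in> M"
        using assms(1) m that by (simp add: complex_vector.subspace_add complex_vector.subspace_scale)
      from min[OF this] show "norm (x + m) \<le> norm (x + m + c *\<^sub>C k)" by (simp add: add.assoc)
    qed
    then have "x + m = 0" by (rule orth)
    then have "x = (-1) *\<^sub>C m"
      by (simp add: complex_vector.scale_minus_left scaleC_one eq_neg_iff_add_eq_0)
    then show ?thesis using assms(1) m complex_vector.subspace_scale by blast
  qed
  then show ?thesis by blast
qed

text \<open>
  The representing vector is a multiple of the shortest solution of \<open>f x = 1\<close>, which is
  orthogonal to the kernel of \<open>f\<close>.
\<close>

lemma riesz_representation:
  fixes f :: "'a :: chilbert_space \<Rightarrow> complex"
  assumes f: "bounded_clinear f"
  shows "\<exists>y. \<forall>x. f x = cinner y x"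
proof (cases "\<forall>x. f x = 0")
  case True
  then show ?thesis by (intro exI[of _ 0]) simp
next
  case False
  then obtain w where w: "f w \<noteq> 0" by blast
  let ?C = "{x. f x = 1}"
  have cont: "continuous_on UNIV f"
    using f by (simp add: bounded_clinear_def linear_continuous_on)
  have "closed ?C" by (intro closed_Collect_eq cont continuous_intros)
  moreover have "convex ?C"
    unfolding convex_def using f
    by (auto simp: bounded_clinear_add bounded_clinear_scaleC scaleC_of_real[symmetric]
        scaleC_complex_eq simp flip: of_real_add)
  moreover have "inverse (f w) *\<^sub>C w \<in> ?C"
    using w f by (simp add: bounded_clinear_scaleC scaleC_complex_eq)
  then have "?C \<noteq> {}" by blast
  ultimately obtain x0 where x0: "f x0 = 1" and min: "\<And>x. f x = 1 \<Longrightarrow> norm x0 \<le> norm x"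
    using exists_minimal_norm[of ?C] by auto
  have orth: "cinner k x0 = 0" if "f k = 0" for k
    by (rule minimal_norm_orthogonal, rule min)
       (use that x0 f in \<open>simp add: bounded_clinear_add bounded_clinear_scaleC scaleC_complex_eq\<close>)
  have nz: "cinner x0 x0 \<noteq> 0" using x0 bounded_clinear_zero[OF f] by (auto simp: cinner_self_eq_0)
  have "f x = cinner ((1 / cnj (cinner x0 x0)) *\<^sub>C x0) x" for x
  proof -
    have "f (x - f x *\<^sub>C x0) = 0"
      using x0 f by (simp add: bounded_clinear_diff bounded_clinear_scaleC scaleC_complex_eq)
    from orth[OF this] have "cinner x0 (x - f x *\<^sub>C x0) = 0" by (metis cinner_commute complex_cnj_zero)
    then show ?thesis
      using nz by (simp add: cinner_diff_right cinner_scaleC_right cinner_scaleC_left)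
  qed
  then show ?thesis by blast
qed

lemma cadjoint_eqI:
  assumes "\<And>x y. cinner (B y) x = cinner y (A x)"
  shows "cadjoint A = B"
  unfolding cadjoint_def
proof (rule the_equality)
  show "C = B" if "\<forall>x y. cinner (C y) x = cinner y (A x)" for C
    by (rule ext, rule cinner_eqI) (use that assms in simp)
qed (use assms in blast)

lemma cinner_cadjoint_left:
  fixes A :: "'a :: chilbert_space \<Rightarrow> 'b :: chilbert_space"
  assumes "bounded_clinear A"
  shows "cinner (cadjoint A y) x = cinner y (A x)"
proof -
  have "\<exists>b. \<forall>x. cinner y (A x) = cinner b x" for y
  proof (rule riesz_representation)
    show "bounded_clinear (\<lambda>x. cinner y (A x))"
      using bounded_clinear_cinner assms by (rule bounded_clinear_compose)
  qed
  then obtain B where "\<And>x y. cinner y (A x) = cinner (B y) x" by metis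
  moreover from this have "cadjoint A = B" by (intro cadjoint_eqI) simp
  ultimately show ?thesis by simp
qed

lemma cinner_cadjoint_right: "bounded_clinear A \<Longrightarrow> cinner x (cadjoint A y) = cinner (A x) y"
  by (metis cinner_cadjoint_left cinner_commute)

lemma
  assumes "bounded_clinear A"
  shows bounded_clinear_cadjoint: "bounded_clinear (cadjoint A)"
    and norm_cadjoint_le: "norm (cadjoint A y) \<le> onorm A * norm y"
proof -
  have *: "norm (cadjoint A y) \<le> onorm A * norm y" for y
  proof (cases "cadjoint A y = 0")
    case True
    then show ?thesis using assms by (simp add: bounded_clinear_onorm_nonneg)
  next
    case False
    have "(norm (cadjoint A y))\<^sup>2 = cmod (cinner (cadjoint A y) (cadjoint A y))"
      by (simp add: cinner_self norm_power)
    also have "\<dots> = cmod (cinner y (A (cadjoint A y)))" using assms by (simp add: cinner_cadjoint_left)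
    also have "\<dots> \<le> norm y * (onorm A * norm (cadjoint A y))"
      using order_trans[OF cmod_cinner_le mult_left_mono[OF bounded_clinear_norm_le[OF assms] norm_ge_zero]] .
    finally show ?thesis using False by (simp add: power2_eq_square mult_ac)
  qed
  then show "norm (cadjoint A y) \<le> onorm A * norm y" .
  show "bounded_clinear (cadjoint A)"
  proof (rule bounded_clinearI[of _ "onorm A"])
    show "cadjoint A (x + y) = cadjoint A x + cadjoint A y" for x y
      by (rule cinner_eqI) (simp add: cinner_add_left cinner_cadjoint_left assms)
    show "cadjoint A (c *\<^sub>C x) = c *\<^sub>C cadjoint A x" for c x
      by (rule cinner_eqI) (simp add: cinner_scaleC_left cinner_cadjoint_left assms)
  qed (use * in \<open>simp add: mult.commute\<close>)
qed


section \<open>Finite orthonormal sets\<close>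

definition orthonormal :: "'a :: chilbert_space set \<Rightarrow> bool"
  where "orthonormal E \<longleftrightarrow> (\<forall>e\<in>E. norm e = 1) \<and> pairwise (\<lambda>x y. cinner x y = 0) E"

definition proj_on :: "'a :: chilbert_space set \<Rightarrow> 'a \<Rightarrow> 'a"
  where "proj_on E x = (\<Sum>e\<in>E. cinner e x *\<^sub>C e)"

lemma cinner_orthonormal:
  assumes "orthonormal E" "e \<in> E" "f \<in> E"
  shows "cinner e f = (if e = f then 1 else 0)"
  using assms by (auto simp: orthonormal_def pairwise_def cinner_self)

lemma orthonormal_subset: "orthonormal E \<Longrightarrow> E' \<subseteq> E \<Longrightarrow> orthonormal E'"
  unfolding orthonormal_def by (auto intro: pairwise_subset)

lemma orthonormal_insert:
  assumes "orthonormal E" "norm e = 1" "\<And>f. f \<in> E \<Longrightarrow> cinner f e = 0"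
  shows "orthonormal (insert e E)"
  using assms unfolding orthonormal_def pairwise_insert
  by (metis cinner_commute complex_cnj_zero insert_iff)

lemma bounded_clinear_proj_on: "bounded_clinear (proj_on E)"
  unfolding proj_on_def[abs_def]
  by (intro bounded_clinear_finite_sum bounded_clinear_cinner_scaleC)

lemma proj_on_in_cspan: "proj_on E x \<in> cspan E"
  unfolding proj_on_def
  by (intro complex_vector.span_sum complex_vector.span_scale complex_vector.span_base)

lemma cinner_proj_on_left: "cinner (proj_on E x) y = cinner x (proj_on E y)"
  unfolding proj_on_def cinner_sum_left cinner_sum_right cinner_scaleC_left cinner_scaleC_right
  by (intro sum.cong refl) (metis cinner_commute mult.commute)

lemma orthogonal_cspan:
  assumes "\<And>e. e \<in> E \<Longrightarrow> cinner e y = 0" "v \<in> cspan E"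
  shows "cinner v y = 0"
proof -
  have "csubspace {v. cinner v y = 0}"
    by (rule complex_vector.subspaceI) (auto simp: cinner_add_left cinner_scaleC_left)
  then have "cspan E \<subseteq> {v. cinner v y = 0}"
    using assms(1) by (intro complex_vector.span_minimal) auto
  then show ?thesis using assms(2) by blast
qed

context
  fixes E :: "'a :: chilbert_space set"
  assumes fin: "finite E" and ortho: "orthonormal E"
begin

lemma cinner_proj_on_member: "e \<in> E \<Longrightarrow> cinner e (proj_on E x) = cinner e x"
  using fin ortho
  by (simp add: proj_on_def cinner_sum_right cinner_scaleC_right cinner_orthonormal if_distrib
      cong: if_cong)

lemma residual_orthogonal: "v \<in> cspan E \<Longrightarrow> cinner v (x - proj_on E x) = 0"
  by (rule orthogonal_cspan) (simp_all add: cinner_diff_right cinner_proj_on_member)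

lemma proj_on_cspan: "v \<in> cspan E \<Longrightarrow> proj_on E v = v"
proof -
  assume v: "v \<in> cspan E"
  have "cinner (v - proj_on E v) (v - proj_on E v) = 0"
    by (intro residual_orthogonal complex_vector.span_diff v proj_on_in_cspan)
  then show ?thesis by (simp add: cinner_self_eq_0)
qed

lemma norm_proj_on: "(norm (proj_on E x))\<^sup>2 = (\<Sum>e\<in>E. (cmod (cinner e x))\<^sup>2)"
proof -
  have "cinner (proj_on E x) (proj_on E x) = cinner x (proj_on E x)"
    by (simp add: cinner_proj_on_left proj_on_cspan proj_on_in_cspan)
  also have "\<dots> = (\<Sum>e\<in>E. cinner e x * cnj (cinner e x))"
    unfolding proj_on_def cinner_sum_right cinner_scaleC_right
    by (intro sum.cong refl) (metis cinner_commute)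
  also have "\<dots> = complex_of_real (\<Sum>e\<in>E. (cmod (cinner e x))\<^sup>2)"
    unfolding of_real_sum by (intro sum.cong refl) (rule complex_norm_square[symmetric])
  finally show ?thesis by (simp add: cinner_self del: of_real_power of_real_sum)
qed

lemma norm_proj_on_le: "norm (proj_on E x) \<le> norm x"
proof -
  have "(norm (proj_on E x + (x - proj_on E x)))\<^sup>2 = (norm (proj_on E x))\<^sup>2 + (norm (x - proj_on E x))\<^sup>2"
    by (intro norm_add_orthogonal residual_orthogonal proj_on_in_cspan)
  then have "(norm (proj_on E x))\<^sup>2 \<le> (norm x)\<^sup>2" by simp
  then show ?thesis by (rule power2_le_imp_le) simp
qed

lemma bessel: "(\<Sum>e\<in>E. (cmod (cinner e x))\<^sup>2) \<le> (norm x)\<^sup>2"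
  using norm_proj_on_le[of x] norm_proj_on[of x] by (metis norm_ge_zero power_mono)

lemma best_approximation:
  assumes "v \<in> cspan E"
  shows "norm (x - proj_on E x) \<le> norm (x - v)"
proof -
  have "(norm ((proj_on E x - v) + (x - proj_on E x)))\<^sup>2 = (norm (proj_on E x - v))\<^sup>2 + (norm (x - proj_on E x))\<^sup>2"
    by (intro norm_add_orthogonal residual_orthogonal complex_vector.span_diff proj_on_in_cspan assms)
  then have "(norm (x - proj_on E x))\<^sup>2 \<le> (norm (x - v))\<^sup>2" by simp
  then show ?thesis by (rule power2_le_imp_le) simp
qed

lemma orthonormal_independent: "\<not> cdependent E"
proof (rule complex_vector.independent_if_scalars_zero[OF fin])
  fix f e assume "(\<Sum>x\<in>E. f x *\<^sub>C x) = 0" "e \<in> E"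
  then have "cinner e (\<Sum>x\<in>E. f x *\<^sub>C x) = 0" by simp
  then show "f e = 0"
    using fin ortho \<open>e \<in> E\<close>
    by (simp add: cinner_sum_right cinner_scaleC_right cinner_orthonormal if_distrib cong: if_cong)
qed

lemma orthonormal_extend:
  assumes "y \<notin> cspan E"
  obtains e c where "norm e = 1" "\<And>f. f \<in> E \<Longrightarrow> cinner f e = 0" "e = c *\<^sub>C (y - proj_on E y)"
    "y \<in> cspan (insert e E)"
proof
  define u where "u = y - proj_on E y"
  define e where "e = complex_of_real (inverse (norm u)) *\<^sub>C u"
  have u: "u \<noteq> 0" using assms proj_on_in_cspan[of E y] by (auto simp: u_def)
  show "norm e = 1" using u by (simp add: e_def norm_scaleC norm_inverse)
  show "cinner f e = 0" if "f \<in> E" for f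
    using residual_orthogonal[OF complex_vector.span_base[OF that]]
    by (simp add: e_def u_def cinner_scaleC_right)
  show "e = complex_of_real (inverse (norm u)) *\<^sub>C (y - proj_on E y)" by (simp add: e_def u_def)
  have "y = proj_on E y + complex_of_real (norm u) *\<^sub>C e"
    using u by (simp add: e_def scaleC_scaleC scaleC_one u_def flip: of_real_mult)
  moreover have "proj_on E y \<in> cspan (insert e E)"
    using proj_on_in_cspan[of E y] complex_vector.span_mono[of E "insert e E"] by blast
  moreover have "complex_of_real (norm u) *\<^sub>C e \<in> cspan (insert e E)"
    by (intro complex_vector.span_scale complex_vector.span_base) simp
  ultimately show "y \<in> cspan (insert e E)" using complex_vector.span_add by metis
qed

end

lemma gram_schmidt:
  assumes "finite S"
  shows "\<exists>E. finite E \<and> orthonormal E \<and> S \<subseteq> cspan E"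
  using assms
proof (induction S)
  case empty
  then show ?case by (intro exI[of _ "{}"]) (simp add: orthonormal_def)
next
  case (insert y S)
  then obtain E where E: "finite E" "orthonormal E" "S \<subseteq> cspan E" by blast
  show ?case
  proof (cases "y \<in> cspan E")
    case True
    then show ?thesis using E by blast
  next
    case False
    obtain e c where e: "norm e = 1" "\<And>f. f \<in> E \<Longrightarrow> cinner f e = 0" "y \<in> cspan (insert e E)"
      using orthonormal_extend[OF E(1,2) False] by metis
    have "S \<subseteq> cspan (insert e E)"
      using E(3) complex_vector.span_mono[of E "insert e E"] by blast
    then show ?thesis
      using e E orthonormal_insert[OF E(2) e(1,2)] by (intro exI[of _ "insert e E"]) auto
  qed
qed

section \<open>Boundedly invertible operators and the Fredholm alternative\<close>

definition bounded_inverse :: "('a :: chilbert_space \<Rightarrow> 'a) \<Rightarrow> ('a \<Rightarrow> 'a) \<Rightarrow> bool"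
  where "bounded_inverse T B \<longleftrightarrow> bounded_clinear B \<and> (\<forall>x. B (T x) = x) \<and> (\<forall>x. T (B x) = x)"

lemma bounded_inverseI:
  assumes T: "bounded_clinear T" and inj: "\<And>x. T x = 0 \<Longrightarrow> x = 0"
    and right: "\<And>y. T (B y) = y" and bound: "\<And>y. norm (B y) \<le> norm y * K"
  shows "bounded_inverse T B"
proof -
  have eqI: "x = y" if "T x = T y" for x y
    using inj[of "x - y"] that T by (simp add: bounded_clinear_diff)
  have "bounded_clinear B"
    by (rule bounded_clinearI[OF _ _ bound])
       (rule eqI, simp add: right bounded_clinear_add[OF T] bounded_clinear_scaleC[OF T])+
  then show ?thesis unfolding bounded_inverse_def using right eqI by blast
qed

text \<open>
  Solving \<open>x + E x = y\<close> is a fixed point problem for the contraction \<open>x \<mapsto> y - E x\<close>; this gives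
  the inverse without summing the Neumann series.
\<close>

lemma neumann_inverse:
  fixes E :: "'a :: chilbert_space \<Rightarrow> 'a"
  assumes E: "bounded_clinear E" and lt: "onorm E < 1"
  shows "\<exists>B. bounded_inverse (\<lambda>x. x + E x) B \<and> onorm B \<le> 1 / (1 - onorm E)"
proof -
  have nn: "0 \<le> onorm E" using E by (rule bounded_clinear_onorm_nonneg)
  have "\<exists>x. x + E x = y" for y
  proof -
    have "\<exists>!x. y - E x = x"
    proof (rule banach_fix_type[OF nn lt], intro allI)
      fix x x'
      have "dist (y - E x) (y - E x') = norm (E (x - x'))"
        by (simp add: dist_norm bounded_clinear_diff[OF E] norm_minus_commute)
      also have "\<dots> \<le> onorm E * dist x x'" unfolding dist_norm by (rule bounded_clinear_norm_le[OF E])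
      finally show "dist (y - E x) (y - E x') \<le> onorm E * dist x x'" .
    qed
    then obtain x where "y - E x = x" by blast
    then show ?thesis by (metis diff_add_cancel)
  qed
  then obtain B where B: "\<And>y. B y + E (B y) = y" by metis
  have lower: "norm x \<le> norm (x + E x) / (1 - onorm E)" for x
  proof -
    have "norm x = norm ((x + E x) - E x)" by simp
    also have "\<dots> \<le> norm (x + E x) + norm (E x)" by (rule norm_triangle_ineq4)
    also have "\<dots> \<le> norm (x + E x) + onorm E * norm x"
      using bounded_clinear_norm_le[OF E] by simp
    finally show ?thesis using lt by (simp add: field_simps)
  qed
  have bound: "norm (B y) \<le> 1 / (1 - onorm E) * norm y" for y
    using lower[of "B y"] by (simp add: B)
  have "bounded_inverse (\<lambda>x. x + E x) B"
  proof (rule bounded_inverseI)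
    show "bounded_clinear (\<lambda>x. x + E x)" by (intro bounded_clinear_plus bounded_clinear_id E)
    show "x = 0" if "x + E x = 0" for x using lower[of x] that by simp
    show "B y + E (B y) = y" for y by (rule B)
    show "norm (B y) \<le> norm y * (1 / (1 - onorm E))" for y
      using bound[of y] by (simp add: mult.commute)
  qed
  moreover have "onorm B \<le> 1 / (1 - onorm E)"
    by (rule onorm_bound[OF _ bound]) (use lt in simp)
  ultimately show ?thesis by blast
qed

text \<open>
  Factor \<open>T + P = (1 + P B) T\<close>, where \<open>B\<close> is the inverse of \<open>T\<close>.
\<close>

lemma bounded_inverse_perturbation:
  assumes T: "bounded_inverse T B" and P: "bounded_clinear P" and lt: "onorm P * onorm B < 1"
  shows "\<exists>C. bounded_inverse (\<lambda>x. T x + P x) C \<and> onorm C \<le> onorm B / (1 - onorm P * onorm B)"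
proof -
  have B: "bounded_clinear B" using T by (simp add: bounded_inverse_def)
  have PB: "bounded_clinear (\<lambda>x. P (B x))" using P B by (rule bounded_clinear_compose)
  have le: "onorm (\<lambda>x. P (B x)) \<le> onorm P * onorm B" using P B by (rule onorm_compose_le)
  with lt have "onorm (\<lambda>x. P (B x)) < 1" by simp
  from neumann_inverse[OF PB this] obtain N
    where N: "bounded_inverse (\<lambda>x. x + P (B x)) N" "onorm N \<le> 1 / (1 - onorm (\<lambda>x. P (B x)))" by blast
  have Ncl: "bounded_clinear N" using N(1) by (simp add: bounded_inverse_def)
  have "bounded_inverse (\<lambda>x. T x + P x) (\<lambda>x. B (N x))"
    unfolding bounded_inverse_def
  proof (intro conjI allI)
    show "bounded_clinear (\<lambda>x. B (N x))" using B Ncl by (rule bounded_clinear_compose)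
    show "B (N (T x + P x)) = x" for x
      using N(1) T unfolding bounded_inverse_def by metis
    show "T (B (N x)) + P (B (N x)) = x" for x
      using N(1) T unfolding bounded_inverse_def by metis
  qed
  moreover have "onorm (\<lambda>x. B (N x)) \<le> onorm B / (1 - onorm P * onorm B)"
  proof -
    have "onorm (\<lambda>x. B (N x)) \<le> onorm B * onorm N" using B Ncl by (rule onorm_compose_le)
    also have "\<dots> \<le> onorm B * (1 / (1 - onorm P * onorm B))"
      using N(2) le lt
      by (intro mult_left_mono order_trans[OF N(2)] divide_left_mono bounded_clinear_onorm_nonneg B)
         (auto intro!: mult_pos_pos)
    finally show ?thesis by simp
  qed
  ultimately show ?thesis by blast
qed

text \<open>
  Injectivity passes to the finite-dimensional range space \<open>R\<close> of \<open>L\<close>, on which \<open>1 + L\<close> is then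
  bijective. The solution of \<open>x + L x = y\<close> is \<open>x = y - r\<close> with \<open>r \<in> R\<close> and \<open>(1 + L) r = L y\<close>; in
  an orthonormal basis of \<open>R\<close> this formula is visibly bounded in \<open>y\<close>.
\<close>

lemma finite_rank_fredholm:
  fixes L :: "'a :: chilbert_space \<Rightarrow> 'a"
  assumes L: "bounded_clinear L" and S: "finite S" "range L \<subseteq> cspan S"
    and inj: "\<And>x. x + L x = 0 \<Longrightarrow> x = 0"
  shows "\<exists>B. bounded_inverse (\<lambda>x. x + L x) B"
proof -
  obtain E where E: "finite E" "orthonormal E" "S \<subseteq> cspan E"
    using gram_schmidt[OF S(1)] by blast
  have ran: "L x \<in> cspan E" for x
    using S(2) complex_vector.span_minimal[OF E(3) complex_vector.subspace_span] by blast
  define T where "T x = x + L x" for x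
  have T: "bounded_clinear T"
    unfolding T_def[abs_def] by (intro bounded_clinear_plus bounded_clinear_id L)
  interpret vp: vector_space_pair "(*\<^sub>C) :: complex \<Rightarrow> 'a \<Rightarrow> 'a" "(*\<^sub>C) :: complex \<Rightarrow> 'a \<Rightarrow> 'a" ..
  have lin: "Vector_Spaces.linear (*\<^sub>C) (*\<^sub>C) T"
    by unfold_locales (simp_all add: bounded_clinear_add[OF T] bounded_clinear_scaleC[OF T])
  have injT: "inj T" unfolding inj_bounded_clinear_iff[OF T] unfolding T_def using inj by blast
  have "T ` E \<subseteq> cspan E"
    unfolding T_def using ran by (auto intro: complex_vector.span_add complex_vector.span_base)
  have indep: "\<not> cdependent (T ` E)"
    using vp.linear_independent_injective_image[OF lin, folded cspan_def cdependent_def,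
        OF orthonormal_independent[OF E(1,2)]] injT inj_on_subset by blast
  have card: "card (T ` E) = card E" using injT by (meson card_image inj_on_subset subset_UNIV)
  \<comment> \<open>\<open>T\<close> maps the finite-dimensional range space injectively into itself, hence onto itself\<close>
  have "e \<in> T ` cspan E" if "e \<in> E" for e
  proof (rule ccontr)
    assume "e \<notin> T ` cspan E"
    then have notin: "e \<notin> cspan (T ` E)"
      by (simp only: vp.linear_span_image[OF lin, folded cspan_def] not_False_eq_True)
    have "e \<notin> T ` E" using complex_vector.span_base[of e "T ` E"] notin by fast
    have "\<not> cdependent (insert e (T ` E))"
      by (rule complex_vector.independent_insertI[OF notin indep])
    moreover have "insert e (T ` E) \<subseteq> cspan E"
      by (rule insert_subsetI[OF complex_vector.span_base[OF that] \<open>T ` E \<subseteq> cspan E\<close>])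
    ultimately have "card (insert e (T ` E)) \<le> card E"
      using complex_vector.independent_span_bound[OF E(1)] by simp
    then show False using \<open>e \<notin> T ` E\<close> E(1) card by simp
  qed
  then have "\<forall>e\<in>E. \<exists>w. T w = e" by force
  then obtain w where w: "\<And>e. e \<in> E \<Longrightarrow> T (w e) = e" by metis
  define B where "B y = y - (\<Sum>e\<in>E. cinner e (L y) *\<^sub>C w e)" for y
  have B: "bounded_clinear B" unfolding B_def[abs_def]
    by (intro bounded_clinear_minus bounded_clinear_id bounded_clinear_finite_sum
        bounded_clinear_compose[OF bounded_clinear_cinner_scaleC L])
  have "T (B y) = y" for y
  proof -
    have "T (B y) = T y - (\<Sum>e\<in>E. cinner e (L y) *\<^sub>C T (w e))"
      by (simp add: B_def bounded_clinear_diff[OF T] bounded_clinear_sum[OF T] bounded_clinear_scaleC[OF T])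
    also have "\<dots> = T y - proj_on E (L y)" by (simp add: proj_on_def w)
    also have "\<dots> = y" using E ran by (simp add: proj_on_cspan T_def)
    finally show ?thesis .
  qed
  moreover have "x = 0" if "T x = 0" for x using that inj unfolding T_def by blast
  moreover have "norm (B y) \<le> norm y * onorm B" for y
    using bounded_clinear_norm_le[OF B, of y] by (simp add: mult.commute)
  ultimately have "bounded_inverse T B" by (intro bounded_inverseI[OF T])
  then show ?thesis unfolding T_def[abs_def] by blast
qed

definition finite_rank_limit :: "('a :: chilbert_space \<Rightarrow> 'b :: chilbert_space) \<Rightarrow> bool"
  where "finite_rank_limit V \<longleftrightarrow> bounded_clinear V \<and>
    (\<forall>\<epsilon>>0. \<exists>S L. finite S \<and> bounded_clinear L \<and> range L \<subseteq> cspan S \<and> onorm (\<lambda>x. V x - L x) < \<epsilon>)"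

lemma range_compose_subset_cspan:
  fixes Y :: "'a :: chilbert_space \<Rightarrow> 'b :: chilbert_space"
  assumes Y: "bounded_clinear Y" and L: "range L \<subseteq> cspan S"
  shows "range (\<lambda>x. Y (L x)) \<subseteq> cspan (Y ` S)"
proof -
  interpret vp: vector_space_pair "(*\<^sub>C) :: complex \<Rightarrow> 'a \<Rightarrow> 'a" "(*\<^sub>C) :: complex \<Rightarrow> 'b \<Rightarrow> 'b" ..
  have lin: "Vector_Spaces.linear (*\<^sub>C) (*\<^sub>C) Y"
    by unfold_locales (simp_all add: bounded_clinear_add[OF Y] bounded_clinear_scaleC[OF Y])
  have "range (\<lambda>x. Y (L x)) \<subseteq> Y ` cspan S" using L by auto
  then show ?thesis by (simp only: cspan_def vp.linear_span_image[OF lin])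
qed

lemma finite_rank_limit_compose:
  assumes Y: "bounded_clinear Y" and V: "finite_rank_limit V"
  shows "finite_rank_limit (\<lambda>x. Y (V x))"
  unfolding finite_rank_limit_def
proof (intro conjI allI impI)
  have Vcl: "bounded_clinear V" using V by (simp add: finite_rank_limit_def)
  show "bounded_clinear (\<lambda>x. Y (V x))" using Y Vcl by (rule bounded_clinear_compose)
  fix \<epsilon> :: real assume "0 < \<epsilon>"
  have Ynn: "0 \<le> onorm Y" using Y by (rule bounded_clinear_onorm_nonneg)
  then have "0 < \<epsilon> / (onorm Y + 1)" using \<open>0 < \<epsilon>\<close> by simp
  then obtain S L where SL: "finite S" "bounded_clinear L" "range L \<subseteq> cspan S"
      "onorm (\<lambda>x. V x - L x) < \<epsilon> / (onorm Y + 1)"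
    using V unfolding finite_rank_limit_def by meson
  have "onorm (\<lambda>x. Y (V x) - Y (L x)) = onorm (\<lambda>x. Y (V x - L x))"
    by (simp add: bounded_clinear_diff[OF Y])
  also have "\<dots> \<le> onorm Y * onorm (\<lambda>x. V x - L x)"
    by (rule onorm_compose_le[OF Y bounded_clinear_minus[OF Vcl SL(2)]])
  also have "\<dots> \<le> onorm Y * (\<epsilon> / (onorm Y + 1))"
    using SL(4) Ynn by (intro mult_left_mono) auto
  also have "\<dots> < \<epsilon>" using Ynn \<open>0 < \<epsilon>\<close> by (simp add: field_simps)
  finally show "\<exists>S L. finite S \<and> bounded_clinear L \<and> range L \<subseteq> cspan S \<and>
      onorm (\<lambda>x. Y (V x) - L x) < \<epsilon>"
    using SL(1) bounded_clinear_compose[OF Y SL(2)] range_compose_subset_cspan[OF Y SL(3)] by blast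
qed

text \<open>
  Split \<open>K = (K - L) + L\<close> with \<open>L\<close> of finite rank and \<open>K - L\<close> of norm below \<open>1\<close>, and let \<open>U\<close> be the
  inverse of \<open>1 + (K - L)\<close>. Then \<open>U (1 + K) = 1 + U L\<close>, and \<open>U L\<close> has finite rank.
\<close>

lemma fredholm_alternative:
  assumes K: "finite_rank_limit K" and inj: "\<And>x. x + K x = 0 \<Longrightarrow> x = 0"
  shows "\<exists>B. bounded_inverse (\<lambda>x. x + K x) B"
proof -
  have Kcl: "bounded_clinear K" using K by (simp add: finite_rank_limit_def)
  have "(0::real) < 1" by simp
  then obtain S L where SL: "finite S" "bounded_clinear L" "range L \<subseteq> cspan S" "onorm (\<lambda>x. K x - L x) < 1"
    using K unfolding finite_rank_limit_def by meson
  obtain U where U: "bounded_inverse (\<lambda>x. x + (K x - L x)) U"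
    using neumann_inverse[OF bounded_clinear_minus[OF Kcl SL(2)] SL(4)] by blast
  have Ucl: "bounded_clinear U" using U by (simp add: bounded_inverse_def)
  have factor: "U (x + K x) = x + U (L x)" for x
  proof -
    have "U (x + K x) = U ((x + (K x - L x)) + L x)" by simp
    also have "\<dots> = U (x + (K x - L x)) + U (L x)" by (rule bounded_clinear_add[OF Ucl])
    also have "U (x + (K x - L x)) = x" using U by (simp add: bounded_inverse_def)
    finally show ?thesis .
  qed
  have Uinj: "y = 0" if "U y = 0" for y
  proof -
    have "U y + (K (U y) - L (U y)) = y" using U by (simp add: bounded_inverse_def)
    then show ?thesis using that by (simp add: bounded_clinear_zero Kcl SL(2))
  qed
  have "\<exists>B. bounded_inverse (\<lambda>x. x + U (L x)) B"
  proof (rule finite_rank_fredholm)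
    show "bounded_clinear (\<lambda>x. U (L x))" using Ucl SL(2) by (rule bounded_clinear_compose)
    show "range (\<lambda>x. U (L x)) \<subseteq> cspan (U ` S)" by (rule range_compose_subset_cspan[OF Ucl SL(3)])
    show "x = 0" if "x + U (L x) = 0" for x
      using that factor[of x] Uinj[of "x + K x"] inj[of x] by metis
  qed (use SL in simp)
  then obtain B where B: "bounded_inverse (\<lambda>x. x + U (L x)) B" by blast
  have "bounded_inverse (\<lambda>x. x + K x) (\<lambda>x. B (U x))"
    unfolding bounded_inverse_def
  proof (intro conjI allI)
    show "bounded_clinear (\<lambda>x. B (U x))"
      by (rule bounded_clinear_compose[OF _ Ucl]) (use B in \<open>simp add: bounded_inverse_def\<close>)
    show "B (U (x + K x)) = x" for x using B by (simp add: factor bounded_inverse_def)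
    show "B (U y) + K (B (U y)) = y" for y
    proof -
      have "U (B (U y) + K (B (U y))) = U y" using B by (simp add: factor bounded_inverse_def)
      then have "U (B (U y) + K (B (U y)) - y) = 0" by (simp add: bounded_clinear_diff[OF Ucl])
      from Uinj[OF this] show ?thesis by simp
    qed
  qed
  then show ?thesis by blast
qed


section \<open>Orthonormal bases and Hilbert--Schmidt operators\<close>

lemma is_onb_orthonormal: "is_onb B \<Longrightarrow> orthonormal B"
  by (simp add: is_onb_def orthonormal_def)

lemma has_sum_finite_sum:
  fixes f :: "'i \<Rightarrow> 'b \<Rightarrow> 'a :: topological_comm_monoid_add"
  assumes "finite I" "\<And>i. i \<in> I \<Longrightarrow> (f i has_sum s i) A"
  shows "((\<lambda>x. \<Sum>i\<in>I. f i x) has_sum (\<Sum>i\<in>I. s i)) A"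
  using assms by (induction I) (auto intro: has_sum_add)

text \<open>
  The projection onto the span of a finite set is the best approximation from that span, so once
  some combination of basis vectors is close to \<open>x\<close>, all larger projections are as close.
\<close>

lemma onb_expansion_tendsto:
  assumes B: "is_onb B"
  shows "((\<lambda>E. proj_on E x) \<longlongrightarrow> x) (finite_subsets_at_top B)"
proof (rule tendstoI)
  fix \<epsilon> :: real assume "0 < \<epsilon>"
  have "x \<in> closure (cspan B)" using B by (simp add: is_onb_def)
  then obtain y where y: "y \<in> cspan B" "dist y x < \<epsilon>"
    using \<open>0 < \<epsilon>\<close> by (meson closure_approachable)
  then obtain t r where t: "finite t" "t \<subseteq> B" "y = (\<Sum>a\<in>t. r a *\<^sub>C a)"
    by (auto simp: complex_vector.span_explicit)
  have "dist (proj_on E x) x < \<epsilon>" if E: "finite E" "t \<subseteq> E" "E \<subseteq> B" for E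
  proof -
    have "y \<in> cspan E" unfolding t(3) using E(2)
      by (intro complex_vector.span_sum complex_vector.span_scale complex_vector.span_base) auto
    then have "norm (x - proj_on E x) \<le> norm (x - y)"
      using E is_onb_orthonormal[OF B] orthonormal_subset by (intro best_approximation) auto
    then show ?thesis using y(2) by (simp add: dist_norm norm_minus_commute)
  qed
  then show "\<forall>\<^sub>F E in finite_subsets_at_top B. dist (proj_on E x) x < \<epsilon>"
    unfolding eventually_finite_subsets_at_top using t by blast
qed

lemma onb_expansion: "is_onb B \<Longrightarrow> ((\<lambda>e. cinner e x *\<^sub>C e) has_sum x) B"
  using onb_expansion_tendsto[of B x] by (simp add: has_sum_def proj_on_def[abs_def])

lemma parseval:
  assumes "is_onb B"
  shows "((\<lambda>e. cinner e x * cinner y e) has_sum cinner y x) B"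
  using has_sum_bounded_linear[OF bounded_clinear_imp_bounded_linear[OF bounded_clinear_cinner]
      onb_expansion[OF assms]]
  by (simp add: cinner_scaleC_right)

lemma parseval_norm:
  assumes "is_onb B"
  shows "((\<lambda>e. (cmod (cinner e x))\<^sup>2) has_sum (norm x)\<^sup>2) B"
proof -
  have "Re (cinner e x * cinner x e) = (cmod (cinner e x))\<^sup>2" for e
    by (metis Re_complex_of_real cinner_commute complex_norm_square)
  then show ?thesis
    using has_sum_Re[OF parseval[OF assms, of x x]] by (simp add: cinner_self)
qed

text \<open>
  The constant is the square of the Hilbert--Schmidt norm in one fixed basis; the point is that
  it controls all finite orthonormal sets at once, so that it does not depend on the basis, and
  that it absorbs bounded operators on the right. Both follow by computing the sum on the adjoint
  side, which turns \<open>F Z\<close> into \<open>Z\<^sup>* F\<^sup>*\<close>.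
\<close>

lemma hilbert_schmidt_bound:
  fixes F :: "'h :: chilbert_space \<Rightarrow> 'k :: chilbert_space"
  assumes "hilbert_schmidt F"
  shows "\<exists>C\<ge>0. \<forall>Z E. bounded_clinear Z \<longrightarrow> finite E \<longrightarrow> orthonormal E \<longrightarrow>
    (\<Sum>e\<in>E. (norm (F (Z e)))\<^sup>2) \<le> C * (onorm (Z :: 'h \<Rightarrow> 'h))\<^sup>2"
proof -
  have F: "bounded_clinear F" using assms by (simp add: hilbert_schmidt_def)
  obtain B where B: "is_onb B" and sm: "(\<lambda>e. (norm (F e))\<^sup>2) summable_on B"
    using assms by (auto simp: hilbert_schmidt_def)
  define C where "C = (\<Sum>\<^sub>\<infinity>e\<in>B. (norm (F e))\<^sup>2)"
  have "0 \<le> C" unfolding C_def by (rule infsum_nonneg) simp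
  moreover have "(\<Sum>e\<in>E. (norm (F (Z e)))\<^sup>2) \<le> C * (onorm Z)\<^sup>2"
    if Z: "bounded_clinear Z" and E: "finite E" "orthonormal E" for Z E
  proof -
    obtain G where G: "finite G" "orthonormal G" "(\<lambda>e. F (Z e)) ` E \<subseteq> cspan G"
      using gram_schmidt[of "(\<lambda>e. F (Z e)) ` E"] E(1) by blast
    have adj: "cmod (cinner g (F (Z e))) = cmod (cinner e (cadjoint Z (cadjoint F g)))" for g e
      by (metis F Z cinner_cadjoint_left cinner_commute complex_mod_cnj)
    have "(norm (F (Z e)))\<^sup>2 = (\<Sum>g\<in>G. (cmod (cinner g (F (Z e))))\<^sup>2)" if "e \<in> E" for e
    proof -
      have "proj_on G (F (Z e)) = F (Z e)" using G that by (intro proj_on_cspan) auto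
      then show ?thesis using norm_proj_on[OF G(1,2), of "F (Z e)"] by simp
    qed
    then have "(\<Sum>e\<in>E. (norm (F (Z e)))\<^sup>2) = (\<Sum>e\<in>E. \<Sum>g\<in>G. (cmod (cinner g (F (Z e))))\<^sup>2)"
      by (intro sum.cong refl)
    also have "\<dots> = (\<Sum>g\<in>G. \<Sum>e\<in>E. (cmod (cinner e (cadjoint Z (cadjoint F g))))\<^sup>2)"
      by (subst sum.swap) (simp add: adj)
    also have "\<dots> \<le> (\<Sum>g\<in>G. (norm (cadjoint Z (cadjoint F g)))\<^sup>2)"
      by (intro sum_mono bessel E)
    also have "\<dots> \<le> (\<Sum>g\<in>G. (onorm Z)\<^sup>2 * (norm (cadjoint F g))\<^sup>2)"
      using norm_cadjoint_le[OF Z] by (intro sum_mono) (simp flip: power_mult_distrib add: power_mono)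
    also have "\<dots> = (onorm Z)\<^sup>2 * (\<Sum>g\<in>G. (norm (cadjoint F g))\<^sup>2)" by (simp add: sum_distrib_left)
    also have "(\<Sum>g\<in>G. (norm (cadjoint F g))\<^sup>2) \<le> C"
    proof (rule has_sum_mono)
      show "((\<lambda>e. \<Sum>g\<in>G. (cmod (cinner e (cadjoint F g)))\<^sup>2) has_sum (\<Sum>g\<in>G. (norm (cadjoint F g))\<^sup>2)) B"
        by (intro has_sum_finite_sum G parseval_norm B)
      show "((\<lambda>e. (norm (F e))\<^sup>2) has_sum C) B" using sm by (simp add: C_def)
      show "(\<Sum>g\<in>G. (cmod (cinner e (cadjoint F g)))\<^sup>2) \<le> (norm (F e))\<^sup>2" for e
      proof -
        have "cmod (cinner e (cadjoint F g)) = cmod (cinner g (F e))" for g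
          by (metis F cinner_cadjoint_left cinner_commute complex_mod_cnj)
        then show ?thesis using bessel[OF G(1,2), of "F e"] by simp
      qed
    qed
    finally show ?thesis by (simp add: mult.commute mult_right_mono)
  qed
  ultimately show ?thesis by blast
qed

text \<open>
  The approximants are \<open>F P\<close> with \<open>P\<close> the projection onto the span of finitely many basis
  vectors. By Cauchy--Schwarz the error is at most the square root of the tail of
  \<open>\<Sum>\<parallel>F e\<parallel>\<^sup>2\<close>.
\<close>

lemma hilbert_schmidt_finite_rank_limit:
  fixes F :: "'h :: chilbert_space \<Rightarrow> 'k :: chilbert_space"
  assumes "hilbert_schmidt F"
  shows "finite_rank_limit F"
  unfolding finite_rank_limit_def
proof (intro conjI allI impI)
  show F: "bounded_clinear F" using assms by (simp add: hilbert_schmidt_def)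
  obtain B where B: "is_onb B" and sm: "(\<lambda>e. (norm (F e))\<^sup>2) summable_on B"
    using assms by (auto simp: hilbert_schmidt_def)
  define C where "C = (\<Sum>\<^sub>\<infinity>e\<in>B. (norm (F e))\<^sup>2)"
  fix \<epsilon> :: real assume "0 < \<epsilon>"
  \<comment> \<open>the estimate below is not strict\<close>
  define \<delta> where "\<delta> = \<epsilon> / 2"
  have \<delta>: "0 < \<delta>" "\<delta> < \<epsilon>" using \<open>0 < \<epsilon>\<close> by (auto simp: \<delta>_def)
  obtain S where S: "finite S" "S \<subseteq> B" "dist (\<Sum>e\<in>S. (norm (F e))\<^sup>2) C \<le> \<delta>\<^sup>2"
    using infsum_finite_approximation[OF sm, of "\<delta>\<^sup>2"] \<delta> by (auto simp: C_def)
  have tail: "(\<Sum>e\<in>E - S. (norm (F e))\<^sup>2) \<le> \<delta>\<^sup>2" if E: "finite E" "S \<subseteq> E" "E \<subseteq> B" for E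
  proof -
    have "(\<Sum>e\<in>E. (norm (F e))\<^sup>2) \<le> C"
      unfolding C_def by (rule finite_sum_le_infsum) (use sm E in auto)
    moreover have "(\<Sum>e\<in>E - S. (norm (F e))\<^sup>2) = (\<Sum>e\<in>E. (norm (F e))\<^sup>2) - (\<Sum>e\<in>S. (norm (F e))\<^sup>2)"
      using E by (intro sum_diff) auto
    ultimately show ?thesis using S(3) by (simp add: dist_real_def abs_le_iff)
  qed
  have "norm (F x - F (proj_on S x)) \<le> \<delta> * norm x" for x
  proof (rule tendsto_upperbound)
    have "isCont (\<lambda>u. norm (F u - F (proj_on S x))) x"
      using F by (intro continuous_intros linear_continuous_at) (simp add: bounded_clinear_def)
    then show "((\<lambda>E. norm (F (proj_on E x) - F (proj_on S x))) \<longlongrightarrow> norm (F x - F (proj_on S x)))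
        (finite_subsets_at_top B)"
      using isCont_tendsto_compose onb_expansion_tendsto[OF B] by blast
    have "norm (F (proj_on E x) - F (proj_on S x)) \<le> \<delta> * norm x"
      if E: "finite E" "S \<subseteq> E" "E \<subseteq> B" for E
    proof -
      have "proj_on E x - proj_on S x = (\<Sum>e\<in>E - S. cinner e x *\<^sub>C e)"
        unfolding proj_on_def using E by (simp add: sum_diff)
      then have "F (proj_on E x) - F (proj_on S x) = (\<Sum>e\<in>E - S. cinner e x *\<^sub>C F e)"
        by (simp add: bounded_clinear_sum[OF F] bounded_clinear_scaleC[OF F] flip: bounded_clinear_diff[OF F])
      then have "norm (F (proj_on E x) - F (proj_on S x)) \<le> (\<Sum>e\<in>E - S. cmod (cinner e x) * norm (F e))"
        by (metis (no_types, lifting) norm_scaleC norm_sum sum.cong)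
      moreover have "(\<Sum>e\<in>E - S. cmod (cinner e x) * norm (F e))\<^sup>2 \<le> (\<delta> * norm x)\<^sup>2"
      proof -
        have "orthonormal (E - S)"
          by (rule orthonormal_subset[OF is_onb_orthonormal[OF B]]) (use E in auto)
        then have "(\<Sum>e\<in>E - S. (cmod (cinner e x))\<^sup>2) \<le> (norm x)\<^sup>2" using E by (intro bessel) auto
        then have "(\<Sum>e\<in>E - S. (cmod (cinner e x))\<^sup>2) * (\<Sum>e\<in>E - S. (norm (F e))\<^sup>2) \<le> (norm x)\<^sup>2 * \<delta>\<^sup>2"
          using tail[OF E] by (intro mult_mono sum_nonneg) auto
        then show ?thesis
          using Cauchy_Schwarz_ineq_sum[of "\<lambda>e. cmod (cinner e x)" "\<lambda>e. norm (F e)" "E - S"]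
          by (simp add: power_mult_distrib mult.commute)
      qed
      then have "(\<Sum>e\<in>E - S. cmod (cinner e x) * norm (F e)) \<le> \<delta> * norm x"
        by (rule power2_le_imp_le) (use \<delta> in simp)
      ultimately show ?thesis by linarith
    qed
    then show "\<forall>\<^sub>F E in finite_subsets_at_top B. norm (F (proj_on E x) - F (proj_on S x)) \<le> \<delta> * norm x"
      unfolding eventually_finite_subsets_at_top using S by blast
  qed simp
  then have "onorm (\<lambda>x. F x - F (proj_on S x)) \<le> \<delta>"
    by (rule onorm_bound[rotated]) (use \<delta> in simp)
  moreover have "range (\<lambda>x. F (proj_on S x)) \<subseteq> cspan (F ` S)"
    by (intro range_compose_subset_cspan F) (use proj_on_in_cspan in blast)
  ultimately show "\<exists>S L. finite S \<and> bounded_clinear L \<and> range L \<subseteq> cspan S \<and> onorm (\<lambda>x. F x - L x) < \<epsilon>"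
    using S(1) \<delta>(2) bounded_clinear_compose[OF F bounded_clinear_proj_on]
    by (intro exI[of _ "F ` S"] exI[of _ "\<lambda>x. F (proj_on S x)"]) auto
qed

section \<open>The trace\<close>

text \<open>
  This states that \<open>V\<close> is trace class with trace norm at most \<open>c\<close>, in the form in which it is
  used: all the traces that occur are those of \<open>X V\<close> with \<open>X\<close> bounded, and the estimate is uniform
  over finite orthonormal sets, so it serves for the sum in a chosen basis as well as for systems
  that are not part of one.
\<close>

definition trace_bounded :: "('h :: chilbert_space \<Rightarrow> 'h) \<Rightarrow> real \<Rightarrow> bool"
  where "trace_bounded V c \<longleftrightarrow> 0 \<le> c \<and> (\<forall>X E. bounded_clinear X \<longrightarrow> finite E \<longrightarrow> orthonormal E \<longrightarrow>
    (\<Sum>e\<in>E. cmod (cinner e (X (V e)))) \<le> c * onorm X)"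

text \<open>
  Moving \<open>X\<close> and \<open>F\<^sup>*\<close> to the left gives \<open>\<langle>e, X F\<^sup>* J F e\<rangle> = \<langle>F X\<^sup>* e, J F e\<rangle>\<close>, a product of two
  square summable factors.
\<close>

lemma frame_perturbation_trace_bounded:
  fixes F :: "'h :: chilbert_space \<Rightarrow> 'k :: chilbert_space"
  assumes "hilbert_schmidt F" and J: "bounded_clinear J"
  shows "\<exists>c. trace_bounded (\<lambda>x. cadjoint F (J (F x))) c"
proof -
  have F: "bounded_clinear F" using assms by (simp add: hilbert_schmidt_def)
  obtain C where C: "0 \<le> C" "\<And>Z E. bounded_clinear Z \<Longrightarrow> finite E \<Longrightarrow> orthonormal E \<Longrightarrow>
      (\<Sum>e\<in>E. (norm (F (Z e)))\<^sup>2) \<le> C * (onorm (Z :: 'h \<Rightarrow> 'h))\<^sup>2"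
    using hilbert_schmidt_bound[OF assms(1)] by metis
  have Jnn: "0 \<le> onorm J" using J by (rule bounded_clinear_onorm_nonneg)
  have "(\<Sum>e\<in>E. cmod (cinner e (X (cadjoint F (J (F e)))))) \<le> onorm J * C * onorm X"
    if X: "bounded_clinear X" and E: "finite E" "orthonormal E" for X E
  proof -
    have Xnn: "0 \<le> onorm X" using X by (rule bounded_clinear_onorm_nonneg)
    have "cmod (cinner e (X (cadjoint F (J (F e))))) \<le> onorm J * (norm (F (cadjoint X e)) * norm (F e))" for e
    proof -
      have "cinner e (X (cadjoint F (J (F e)))) = cinner (F (cadjoint X e)) (J (F e))"
        using F X by (simp add: cinner_cadjoint_right flip: cinner_cadjoint_left)
      then have "cmod (cinner e (X (cadjoint F (J (F e))))) \<le> norm (F (cadjoint X e)) * norm (J (F e))"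
        by (simp add: cmod_cinner_le)
      also have "\<dots> \<le> norm (F (cadjoint X e)) * (onorm J * norm (F e))"
        by (intro mult_left_mono bounded_clinear_norm_le J) simp
      finally show ?thesis by (simp add: mult_ac)
    qed
    then have "(\<Sum>e\<in>E. cmod (cinner e (X (cadjoint F (J (F e))))))
        \<le> onorm J * (\<Sum>e\<in>E. norm (F (cadjoint X e)) * norm (F e))"
      unfolding sum_distrib_left by (rule sum_mono)
    also have "(\<Sum>e\<in>E. norm (F (cadjoint X e)) * norm (F e)) \<le> C * onorm X"
    proof (rule power2_le_imp_le)
      have "onorm (cadjoint X) \<le> onorm X"
        by (rule onorm_bound[OF Xnn norm_cadjoint_le[OF X]])
      then have "C * (onorm (cadjoint X))\<^sup>2 \<le> C * (onorm X)\<^sup>2"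
        using C(1) by (intro mult_left_mono power_mono bounded_clinear_onorm_nonneg bounded_clinear_cadjoint X)
      then have 1: "(\<Sum>e\<in>E. (norm (F (cadjoint X e)))\<^sup>2) \<le> C * (onorm X)\<^sup>2"
        using C(2)[OF bounded_clinear_cadjoint[OF X] E] by simp
      have "onorm (\<lambda>x :: 'h. x) \<le> 1" by (rule onorm_bound) simp_all
      then have "C * (onorm (\<lambda>x :: 'h. x))\<^sup>2 \<le> C"
        using C(1) bounded_clinear_onorm_nonneg[OF bounded_clinear_id]
        by (intro mult_left_le power_le_one)
      then have 2: "(\<Sum>e\<in>E. (norm (F e))\<^sup>2) \<le> C"
        using C(2)[OF bounded_clinear_id E] by simp
      have "(\<Sum>e\<in>E. norm (F (cadjoint X e)) * norm (F e))\<^sup>2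
          \<le> (\<Sum>e\<in>E. (norm (F (cadjoint X e)))\<^sup>2) * (\<Sum>e\<in>E. (norm (F e))\<^sup>2)"
        by (rule Cauchy_Schwarz_ineq_sum)
      also have "\<dots> \<le> (C * (onorm X)\<^sup>2) * C"
        using 1 2 C(1) by (intro mult_mono sum_nonneg) auto
      finally show "(\<Sum>e\<in>E. norm (F (cadjoint X e)) * norm (F e))\<^sup>2 \<le> (C * onorm X)\<^sup>2"
        by (simp add: power2_eq_square mult_ac)
    qed (use C(1) Xnn in simp)
    finally show ?thesis using Jnn by (simp add: mult_right_mono mult_ac)
  qed
  then show ?thesis unfolding trace_bounded_def using Jnn C(1) by (intro exI[of _ "onorm J * C"]) auto
qed

context
  fixes V :: "'h :: chilbert_space \<Rightarrow> 'h" and c :: real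
  assumes V: "trace_bounded V c" and ex_onb: "\<exists>B :: 'h set. is_onb B"
begin

lemma is_onb_chosen: "is_onb (SOME B :: 'h set. is_onb B)"
  using ex_onb by (rule someI_ex)

lemma trace_summable:
  assumes X: "bounded_clinear X"
  shows "(\<lambda>e. cmod (cinner e (X (V e)))) summable_on (SOME B. is_onb B)"
  unfolding abs_summable_iff_bdd_above
proof (rule bdd_aboveI)
  fix t assume "t \<in> sum (\<lambda>e. cmod (cinner e (X (V e)))) ` {E. E \<subseteq> (SOME B. is_onb B) \<and> finite E}"
  then obtain E where E: "finite E" "E \<subseteq> (SOME B. is_onb B)" "t = (\<Sum>e\<in>E. cmod (cinner e (X (V e))))"
    by auto
  moreover have "orthonormal E"
    using orthonormal_subset[OF is_onb_orthonormal[OF is_onb_chosen] E(2)] .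
  ultimately show "t \<le> c * onorm X" using V X by (auto simp: trace_bounded_def)
qed

lemma cmod_trace_le:
  assumes X: "bounded_clinear X"
  shows "cmod (trace_op (\<lambda>x. X (V x))) \<le> c * onorm X"
proof -
  have "cmod (trace_op (\<lambda>x. X (V x))) \<le> (\<Sum>\<^sub>\<infinity>e\<in>(SOME B. is_onb B). cmod (cinner e (X (V e))))"
    unfolding trace_op_def by (rule norm_infsum_bound[OF trace_summable[OF X]])
  also have "\<dots> \<le> c * onorm X"
  proof (rule infsum_le_finite_sums[OF trace_summable[OF X]])
    fix E :: "'h set" assume E: "finite E" "E \<subseteq> (SOME B. is_onb B)"
    have "orthonormal E"
      using orthonormal_subset[OF is_onb_orthonormal[OF is_onb_chosen] E(2)] .
    then show "(\<Sum>e\<in>E. cmod (cinner e (X (V e)))) \<le> c * onorm X"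
      using V X E by (auto simp: trace_bounded_def)
  qed
  finally show ?thesis .
qed

lemma trace_linear:
  assumes X: "bounded_clinear X" and Y: "bounded_clinear Y"
  shows "trace_op (\<lambda>x. a *\<^sub>C X (V x) + b *\<^sub>C Y (V x)) =
    a * trace_op (\<lambda>x. X (V x)) + b * trace_op (\<lambda>x. Y (V x))"
proof -
  have "((\<lambda>e. cinner e (X (V e))) has_sum trace_op (\<lambda>x. X (V x))) (SOME B. is_onb B)"
    "((\<lambda>e. cinner e (Y (V e))) has_sum trace_op (\<lambda>x. Y (V x))) (SOME B. is_onb B)"
    unfolding trace_op_def
    using X Y by (auto intro!: has_sum_infsum abs_summable_summable trace_summable)
  then have "((\<lambda>e. a * cinner e (X (V e)) + b * cinner e (Y (V e))) has_sum
      (a * trace_op (\<lambda>x. X (V x)) + b * trace_op (\<lambda>x. Y (V x)))) (SOME B. is_onb B)"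
    by (intro has_sum_add has_sum_cmult_right)
  then show ?thesis
    unfolding trace_op_def[of "\<lambda>x. a *\<^sub>C X (V x) + b *\<^sub>C Y (V x)"]
    by (intro infsumI) (simp add: cinner_add_right cinner_scaleC_right)
qed

end

text \<open>
  The trace of \<open>Q A\<close> with \<open>Q\<close> of finite rank is computed by Parseval's identity from an
  orthonormal basis of the range of \<open>Q\<close>, whatever basis the trace is defined with.
\<close>

lemma trace_proj_on:
  fixes A :: "'h :: chilbert_space \<Rightarrow> 'h"
  assumes "\<exists>B :: 'h set. is_onb B" and E: "finite E" and A: "bounded_clinear A"
  shows "trace_op (\<lambda>x. proj_on E (A x)) = (\<Sum>u\<in>E. cinner u (A u))"
proof -
  have onb: "is_onb (SOME B :: 'h set. is_onb B)" using assms(1) by (rule someI_ex)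
  have "((\<lambda>e. \<Sum>u\<in>E. cinner e u * cinner (cadjoint A u) e) has_sum (\<Sum>u\<in>E. cinner (cadjoint A u) u))
      (SOME B. is_onb B)"
    by (intro has_sum_finite_sum E parseval onb)
  then have "((\<lambda>e. cinner e (proj_on E (A e))) has_sum (\<Sum>u\<in>E. cinner u (A u))) (SOME B. is_onb B)"
    by (simp add: proj_on_def cinner_sum_right cinner_scaleC_right cinner_cadjoint_left[OF A] mult.commute)
  then show ?thesis unfolding trace_op_def by (rule infsumI)
qed


section \<open>Resolvents of self-adjoint operators\<close>

lemma selfadjoint_on_symmetric:
  assumes "selfadjoint_on D H" "x \<in> D" "y \<in> D"
  shows "cinner y (H x) = cinner (H y) x"
proof -
  have "(y, H y) \<in> adjoint_graph D H" using assms by (auto simp: selfadjoint_on_def)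
  then show ?thesis using assms(2) by (simp add: adjoint_graph_def)
qed

text \<open>
  The inclusion of the adjoint graph in the graph: this is what distinguishes self-adjoint from
  symmetric operators, and yields closedness and surjectivity of \<open>H - z\<close> below.
\<close>

lemma selfadjoint_on_maximal:
  assumes "selfadjoint_on D H" "\<And>x. x \<in> D \<Longrightarrow> cinner y (H x) = cinner w x"
  shows "y \<in> D \<and> H y = w"
proof -
  have "(y, w) \<in> adjoint_graph D H" using assms(2) by (simp add: adjoint_graph_def)
  then show ?thesis using assms(1) by (auto simp: selfadjoint_on_def)
qed

lemma selfadjoint_on_perturbation:
  assumes H: "selfadjoint_on D H" and V: "bounded_clinear V" and sym: "\<And>x y. cinner (V y) x = cinner y (V x)"
  shows "selfadjoint_on D (\<lambda>y. H y + s *\<^sub>R V y)"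
  unfolding selfadjoint_on_def
proof (intro conjI ballI allI)
  show "csubspace D" "closure D = UNIV" using H by (auto simp: selfadjoint_on_def)
  show "H (x + y) + s *\<^sub>R V (x + y) = H x + s *\<^sub>R V x + (H y + s *\<^sub>R V y)" if "x \<in> D" "y \<in> D" for x y
    using H that by (simp add: selfadjoint_on_def bounded_clinear_add[OF V] scaleR_add_right)
  show "H (c *\<^sub>C x) + s *\<^sub>R V (c *\<^sub>C x) = c *\<^sub>C (H x + s *\<^sub>R V x)" if "x \<in> D" for c x
    using H that
    by (simp add: selfadjoint_on_def bounded_clinear_scaleC[OF V] scaleC_add_right scaleC_scaleC mult.commute
        flip: scaleC_of_real)
  have s_left: "cinner (s *\<^sub>R u) v = complex_of_real s * cinner u v"
    and s_right: "cinner u (s *\<^sub>R v) = complex_of_real s * cinner u v" for u v :: 'a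
    by (simp_all add: cinner_scaleC_left cinner_scaleC_right flip: scaleC_of_real)
  show "adjoint_graph D (\<lambda>y. H y + s *\<^sub>R V y) = (\<lambda>x. (x, H x + s *\<^sub>R V x)) ` D"
  proof (intro equalityI subsetI)
    fix p assume p: "p \<in> adjoint_graph D (\<lambda>y. H y + s *\<^sub>R V y)"
    obtain y w where yw: "p = (y, w)" by force
    have "cinner y (H x) = cinner (w - s *\<^sub>R V y) x" if "x \<in> D" for x
    proof -
      have "cinner y (H x + s *\<^sub>R V x) = cinner w x"
        using p that by (simp add: yw adjoint_graph_def)
      then show ?thesis
        by (simp add: cinner_add_right cinner_diff_left s_left s_right sym eq_diff_eq)
    qed
    from selfadjoint_on_maximal[OF H this] show "p \<in> (\<lambda>x. (x, H x + s *\<^sub>R V x)) ` D"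
      by (force simp: yw)
  next
    fix p assume "p \<in> (\<lambda>x. (x, H x + s *\<^sub>R V x)) ` D"
    then show "p \<in> adjoint_graph D (\<lambda>y. H y + s *\<^sub>R V y)"
      using selfadjoint_on_symmetric[OF H]
      by (auto simp: adjoint_graph_def cinner_add_right cinner_add_left s_left s_right sym)
  qed
qed

text \<open>
  \<open>\<langle>x, H x\<rangle>\<close> is real, so the imaginary part of \<open>\<langle>x, (H - z) x\<rangle>\<close> is \<open>- Im z \<parallel>x\<parallel>\<^sup>2\<close>.
\<close>

lemma selfadjoint_on_lower_bound:
  assumes H: "selfadjoint_on D H" and x: "x \<in> D"
  shows "\<bar>Im z\<bar> * norm x \<le> norm (H x - z *\<^sub>C x)"
proof (cases "x = 0")
  case False
  have "cinner x (H x) = cnj (cinner x (H x))"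
    using selfadjoint_on_symmetric[OF H x x] by (metis cinner_commute)
  then have "Im (cinner x (H x)) = 0" by (metis Reals_cnj_iff complex_is_Real_iff)
  then have "\<bar>Im z\<bar> * (norm x)\<^sup>2 = \<bar>Im (cinner x (H x - z *\<^sub>C x))\<bar>"
    by (simp add: cinner_diff_right cinner_scaleC_right cinner_self abs_mult del: of_real_power)
  also have "\<dots> \<le> norm x * norm (H x - z *\<^sub>C x)"
    by (rule order_trans[OF abs_Im_le_cmod cmod_cinner_le])
  finally show ?thesis using False by (simp add: power2_eq_square mult_ac)
qed simp

context
  fixes D :: "'h :: chilbert_space set" and H :: "'h \<Rightarrow> 'h" and z :: complex
  assumes H: "selfadjoint_on D H" and z: "z \<notin> \<real>"
begin

lemma Im_pos: "0 < \<bar>Im z\<bar>"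
  using z by (simp add: complex_is_Real_iff)

lemma shifted_add: "x \<in> D \<Longrightarrow> y \<in> D \<Longrightarrow> H (x + y) - z *\<^sub>C (x + y) = (H x - z *\<^sub>C x) + (H y - z *\<^sub>C y)"
  using H by (simp add: selfadjoint_on_def scaleC_add_right)

lemma shifted_scaleC: "x \<in> D \<Longrightarrow> H (c *\<^sub>C x) - z *\<^sub>C (c *\<^sub>C x) = c *\<^sub>C (H x - z *\<^sub>C x)"
  using H by (simp add: selfadjoint_on_def complex_vector.scale_right_diff_distrib scaleC_scaleC mult.commute)

lemma domain_csubspace: "csubspace D"
  using H by (simp add: selfadjoint_on_def)

lemma shifted_diff:
  assumes "x \<in> D" "y \<in> D"
  shows "H (x - y) - z *\<^sub>C (x - y) = (H x - z *\<^sub>C x) - (H y - z *\<^sub>C y)"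
proof -
  have "x - y \<in> D" using domain_csubspace assms by (rule complex_vector.subspace_diff)
  from shifted_add[OF this assms(2)]
  have "(H (x - y) - z *\<^sub>C (x - y)) + (H y - z *\<^sub>C y) = H x - z *\<^sub>C x"
    by (simp only: diff_add_cancel)
  then show ?thesis by (rule add_implies_diff)
qed

lemma shifted_inj: "inj_on (\<lambda>x. H x - z *\<^sub>C x) D"
proof (rule inj_onI)
  fix x y assume xy: "x \<in> D" "y \<in> D" "H x - z *\<^sub>C x = H y - z *\<^sub>C y"
  have "x - y \<in> D" using domain_csubspace xy(1,2) by (rule complex_vector.subspace_diff)
  from selfadjoint_on_lower_bound[OF H this, of z] have "\<bar>Im z\<bar> * norm (x - y) \<le> 0"
    using shifted_diff[OF xy(1,2)] xy(3) by simp
  then show "x = y" using Im_pos by (simp add: mult_le_0_iff)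
qed

text \<open>
  By the lower bound, convergence of \<open>(H - z) x\<^sub>n\<close> forces convergence of \<open>x\<^sub>n\<close>, and the graph of
  \<open>H\<close> is closed because it is an adjoint graph.
\<close>

lemma shifted_range_closed: "closed ((\<lambda>x. H x - z *\<^sub>C x) ` D)"
  unfolding closed_sequential_limits
proof (intro allI impI, elim conjE)
  fix y l assume y: "\<forall>n. y n \<in> (\<lambda>x. H x - z *\<^sub>C x) ` D" and lim: "y \<longlonglongrightarrow> l"
  have "\<exists>x. x \<in> D \<and> y n = H x - z *\<^sub>C x" for n
    using y by (simp add: image_iff) blast
  then obtain x where x: "\<And>n. x n \<in> D" "\<And>n. y n = H (x n) - z *\<^sub>C x n" by metis
  have "Cauchy x"
  proof (rule metric_CauchyI)
    fix e :: real assume "0 < e"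
    then have "0 < \<bar>Im z\<bar> * e" using Im_pos by simp
    then obtain M where M: "\<And>m n. m \<ge> M \<Longrightarrow> n \<ge> M \<Longrightarrow> dist (y m) (y n) < \<bar>Im z\<bar> * e"
      using metric_CauchyD[OF LIMSEQ_imp_Cauchy[OF lim]] by blast
    have "dist (x m) (x n) < e" if "m \<ge> M" "n \<ge> M" for m n
    proof -
      have "x m - x n \<in> D" using domain_csubspace x(1) x(1) by (rule complex_vector.subspace_diff)
      from selfadjoint_on_lower_bound[OF H this, of z]
      have "\<bar>Im z\<bar> * dist (x m) (x n) \<le> dist (y m) (y n)"
        using x by (simp only: shifted_diff dist_norm)
      also have "\<dots> < \<bar>Im z\<bar> * e" using M that by blast
      finally show ?thesis using Im_pos by simp
    qed
    then show "\<exists>M. \<forall>m\<ge>M. \<forall>n\<ge>M. dist (x m) (x n) < e" by blast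
  qed
  then obtain \<xi> where \<xi>: "x \<longlonglongrightarrow> \<xi>" using Cauchy_convergent convergent_def by blast
  have cont: "(\<lambda>n. cinner u (w n)) \<longlonglongrightarrow> cinner u v" if "w \<longlonglongrightarrow> v" for u v :: 'h and w
    using bounded_clinear_imp_bounded_linear[OF bounded_clinear_cinner] that by (rule bounded_linear.tendsto)
  have "(\<lambda>n. z *\<^sub>C x n) \<longlonglongrightarrow> z *\<^sub>C \<xi>"
    using bounded_clinear_imp_bounded_linear[OF bounded_clinear_scaleC_fun[OF bounded_clinear_id]] \<xi>
    by (rule bounded_linear.tendsto)
  then have "(\<lambda>n. y n + z *\<^sub>C x n) \<longlonglongrightarrow> l + z *\<^sub>C \<xi>" by (intro tendsto_add lim)
  then have Hx: "(\<lambda>n. H (x n)) \<longlonglongrightarrow> l + z *\<^sub>C \<xi>" by (simp add: x(2))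
  have "cinner \<xi> (H u) = cinner (l + z *\<^sub>C \<xi>) u" if u: "u \<in> D" for u
  proof -
    have "(\<lambda>n. cinner (H u) (x n)) \<longlonglongrightarrow> cinner u (l + z *\<^sub>C \<xi>)"
      using cont[OF Hx, of u] selfadjoint_on_symmetric[OF H x(1) u] by simp
    moreover have "(\<lambda>n. cinner (H u) (x n)) \<longlonglongrightarrow> cinner (H u) \<xi>" by (rule cont[OF \<xi>])
    ultimately have "cinner (H u) \<xi> = cinner u (l + z *\<^sub>C \<xi>)" using LIMSEQ_unique by blast
    then show ?thesis by (metis cinner_commute)
  qed
  from selfadjoint_on_maximal[OF H this] have "\<xi> \<in> D" "H \<xi> = l + z *\<^sub>C \<xi>" by auto
  then show "l \<in> (\<lambda>x. H x - z *\<^sub>C x) ` D" by (intro image_eqI[of _ _ \<xi>]) auto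
qed

text \<open>
  A vector orthogonal to the range is in the domain of the adjoint and an eigenvector of \<open>H\<close> for the
  conjugate of \<open>z\<close>, which the lower bound excludes.
\<close>

lemma shifted_surj: "(\<lambda>x. H x - z *\<^sub>C x) ` D = UNIV"
proof (rule closed_csubspace_eq_UNIV[OF _ shifted_range_closed])
  show "csubspace ((\<lambda>x. H x - z *\<^sub>C x) ` D)"
  proof (rule complex_vector.subspaceI)
    have "0 \<in> D" by (rule complex_vector.subspace_0[OF domain_csubspace])
    moreover from shifted_scaleC[OF this, of 0] have "H 0 - z *\<^sub>C 0 = 0" by simp
    ultimately show "0 \<in> (\<lambda>x. H x - z *\<^sub>C x) ` D" by force
  next
    fix a b assume "a \<in> (\<lambda>x. H x - z *\<^sub>C x) ` D" "b \<in> (\<lambda>x. H x - z *\<^sub>C x) ` D"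
    then obtain x y where xy: "x \<in> D" "y \<in> D" "a = H x - z *\<^sub>C x" "b = H y - z *\<^sub>C y" by blast
    have "x + y \<in> D" using domain_csubspace xy(1,2) by (rule complex_vector.subspace_add)
    then show "a + b \<in> (\<lambda>x. H x - z *\<^sub>C x) ` D"
      unfolding xy(3,4) shifted_add[OF xy(1,2), symmetric] by (rule imageI)
  next
    fix c a assume "a \<in> (\<lambda>x. H x - z *\<^sub>C x) ` D"
    then obtain x where x: "x \<in> D" "a = H x - z *\<^sub>C x" by blast
    have "c *\<^sub>C x \<in> D" using domain_csubspace x(1) by (rule complex_vector.subspace_scale)
    then show "c *\<^sub>C a \<in> (\<lambda>x. H x - z *\<^sub>C x) ` D"
      unfolding x(2) shifted_scaleC[OF x(1), symmetric] by (rule imageI)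
  qed
next
  fix u assume u: "\<And>k. k \<in> (\<lambda>x. H x - z *\<^sub>C x) ` D \<Longrightarrow> cinner k u = 0"
  have "cinner u (H x) = cinner (cnj z *\<^sub>C u) x" if "x \<in> D" for x
  proof -
    have "cinner (H x - z *\<^sub>C x) u = 0" by (rule u[OF imageI[OF that]])
    then have "cinner u (H x - z *\<^sub>C x) = 0"
      using cinner_commute[of u "H x - z *\<^sub>C x"] by simp
    then show ?thesis by (simp add: cinner_diff_right cinner_scaleC_right cinner_scaleC_left)
  qed
  from selfadjoint_on_maximal[OF H this] have "u \<in> D" "H u = cnj z *\<^sub>C u" by auto
  then show "u = 0"
    using selfadjoint_on_lower_bound[OF H, of u "cnj z"] Im_pos by (simp add: mult_le_0_iff)
qed

lemma
  shows resolvent_in_domain: "resolvent D H z y \<in> D"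
    and resolvent_right: "H (resolvent D H z y) - z *\<^sub>C resolvent D H z y = y"
proof -
  have y: "y \<in> (\<lambda>x. H x - z *\<^sub>C x) ` D" by (simp only: shifted_surj UNIV_I)
  show "resolvent D H z y \<in> D" unfolding resolvent_def using y by (rule inv_into_into)
  show "H (resolvent D H z y) - z *\<^sub>C resolvent D H z y = y"
    unfolding resolvent_def using y by (rule f_inv_into_f)
qed

lemma resolvent_left: "x \<in> D \<Longrightarrow> resolvent D H z (H x - z *\<^sub>C x) = x"
  unfolding resolvent_def by (rule inv_into_f_f[OF shifted_inj])

lemma bounded_clinear_resolvent: "bounded_clinear (resolvent D H z)"
proof (rule bounded_clinearI[of _ "1 / \<bar>Im z\<bar>"])
  let ?R = "resolvent D H z"
  show "?R (x + y) = ?R x + ?R y" for x y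
  proof -
    have "?R x + ?R y \<in> D"
      using domain_csubspace resolvent_in_domain resolvent_in_domain by (rule complex_vector.subspace_add)
    from resolvent_left[OF this] show ?thesis
      by (simp only: shifted_add resolvent_in_domain resolvent_right)
  qed
  show "?R (c *\<^sub>C x) = c *\<^sub>C ?R x" for c x
  proof -
    have "c *\<^sub>C ?R x \<in> D"
      using domain_csubspace resolvent_in_domain by (rule complex_vector.subspace_scale)
    from resolvent_left[OF this] show ?thesis
      by (simp only: shifted_scaleC resolvent_in_domain resolvent_right)
  qed
  show "norm (?R x) \<le> norm x * (1 / \<bar>Im z\<bar>)" for x
    using selfadjoint_on_lower_bound[OF H resolvent_in_domain, of z x] Im_pos
    by (simp add: resolvent_right field_simps)
qed

end

lemma cadjoint_resolvent:
  assumes H: "selfadjoint_on D H" and z: "z \<notin> \<real>"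
  shows "cadjoint (resolvent D H z) = resolvent D H (cnj z)"
proof (rule cadjoint_eqI)
  fix x y
  let ?R = "resolvent D H z" and ?R' = "resolvent D H (cnj z)"
  have z': "cnj z \<notin> \<real>" using z by (simp add: complex_is_Real_iff)
  have "cinner (?R' y) x = cinner (?R' y) (H (?R x) - z *\<^sub>C ?R x)"
    by (simp add: resolvent_right[OF H z])
  also have "\<dots> = cinner (H (?R' y) - cnj z *\<^sub>C ?R' y) (?R x)"
    using selfadjoint_on_symmetric[OF H resolvent_in_domain[OF H z] resolvent_in_domain[OF H z']]
    by (simp add: cinner_diff_right cinner_diff_left cinner_scaleC_right cinner_scaleC_left)
  also have "\<dots> = cinner y (?R x)" by (simp add: resolvent_right[OF H z'])
  finally show "cinner (?R' y) x = cinner y (?R x)" .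
qed

text \<open>The second resolvent identity, in the form \<open>R\<^sub>z(H + s V) = (1 + s R\<^sub>z(H) V)\<^sup>-\<^sup>1 R\<^sub>z(H)\<close>.\<close>

lemma
  assumes H: "selfadjoint_on D H" and z: "z \<notin> \<real>" and V: "bounded_clinear V"
    and sym: "\<And>x y. cinner (V y) x = cinner y (V x)"
  shows resolvent_perturbation: "resolvent D (\<lambda>y. H y + s *\<^sub>R V y) z y
      + complex_of_real s *\<^sub>C resolvent D H z (V (resolvent D (\<lambda>y. H y + s *\<^sub>R V y) z y)) = resolvent D H z y"
    and resolvent_perturbation_inj: "x + complex_of_real s *\<^sub>C resolvent D H z (V x) = 0 \<Longrightarrow> x = 0"
proof -
  let ?H = "\<lambda>y. H y + s *\<^sub>R V y" and ?R = "resolvent D H z"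
  have Hs: "selfadjoint_on D ?H" using H V sym by (rule selfadjoint_on_perturbation)
  note R = bounded_clinear_resolvent[OF H z]
  let ?u = "resolvent D ?H z y"
  have u: "?u \<in> D" "?H ?u - z *\<^sub>C ?u = y"
    by (rule resolvent_in_domain[OF Hs z], rule resolvent_right[OF Hs z])
  then have "?R y = ?R ((H ?u - z *\<^sub>C ?u) + complex_of_real s *\<^sub>C V ?u)"
    by (simp add: scaleC_of_real algebra_simps)
  also have "\<dots> = ?u + complex_of_real s *\<^sub>C ?R (V ?u)"
    by (simp add: bounded_clinear_add[OF R] bounded_clinear_scaleC[OF R] resolvent_left[OF H z u(1)])
  finally show "?u + complex_of_real s *\<^sub>C ?R (V ?u) = ?R y" by simp
  assume x: "x + complex_of_real s *\<^sub>C ?R (V x) = 0"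
  moreover have "?R (- (complex_of_real s *\<^sub>C V x)) + complex_of_real s *\<^sub>C ?R (V x) = 0"
    using bounded_clinear_scaleC[OF R, of "- complex_of_real s" "V x"]
    by (simp add: complex_vector.scale_minus_left)
  ultimately have x_eq: "x = ?R (- (complex_of_real s *\<^sub>C V x))" by (metis add_right_cancel)
  have "x \<in> D" by (subst x_eq) (rule resolvent_in_domain[OF H z])
  moreover have "H x - z *\<^sub>C x = - (complex_of_real s *\<^sub>C V x)"
    using resolvent_right[OF H z, of "- (complex_of_real s *\<^sub>C V x)"] x_eq by simp
  then have "?H x - z *\<^sub>C x = 0" by (simp add: scaleC_of_real algebra_simps)
  ultimately have "\<bar>Im z\<bar> * norm x \<le> 0"
    using selfadjoint_on_lower_bound[OF Hs, of x z] by simp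
  then show "x = 0" using z by (simp add: mult_le_0_iff complex_is_Real_iff)
qed


section \<open>Root spaces of trace class operators\<close>

text \<open>
  Lists are built from the head, so the vectors appear in reverse order: each vector is
  mapped by \<open>A - \<mu>\<close> into the span of the vectors \<^emph>\<open>after\<close> it in the list. In this basis \<open>A\<close> is
  triangular with \<open>\<mu>\<close> along the diagonal.
\<close>

inductive triangular :: "('h :: chilbert_space \<Rightarrow> 'h) \<Rightarrow> complex \<Rightarrow> 'h list \<Rightarrow> bool" for A \<mu> where
  Nil: "triangular A \<mu> []"
| Cons: "triangular A \<mu> xs \<Longrightarrow> norm x = 1 \<Longrightarrow> (\<And>e. e \<in> set xs \<Longrightarrow> cinner e x = 0) \<Longrightarrow>
    A x - \<mu> *\<^sub>C x \<in> cspan (set xs) \<Longrightarrow> triangular A \<mu> (x # xs)"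

text \<open>
  The space whose dimension is \<^const>\<open>algebraic_multiplicity\<close>.
\<close>

definition root_space :: "('h :: chilbert_space \<Rightarrow> 'h) \<Rightarrow> complex \<Rightarrow> 'h set"
  where "root_space A \<mu> = (\<Union>n. {x. ((\<lambda>y. A y - \<mu> *\<^sub>C y) ^^ n) x = 0})"

lemma triangular_orthonormal: "triangular A \<mu> xs \<Longrightarrow> orthonormal (set xs) \<and> distinct xs"
proof (induction rule: triangular.induct)
  case Nil
  then show ?case by (simp add: orthonormal_def)
next
  case (Cons xs x)
  have "x \<notin> set xs"
  proof
    assume "x \<in> set xs"
    then have "cinner x x = 0" by (rule Cons.hyps(3))
    then show False using Cons.hyps(2) by (simp add: cinner_self)
  qed
  then show ?case using Cons orthonormal_insert by auto
qed

lemma orthogonal_cspan_right: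
  assumes "\<And>e. e \<in> E \<Longrightarrow> cinner e x = 0" "w \<in> cspan E"
  shows "cinner x w = 0"
  using orthogonal_cspan[OF assms] cinner_commute[of x w] by simp

context
  fixes A :: "'h :: chilbert_space \<Rightarrow> 'h" and \<mu> :: complex
  assumes A: "bounded_clinear A"
begin

lemma bounded_clinear_shift: "bounded_clinear (\<lambda>y. A y - \<mu> *\<^sub>C y)"
  by (intro bounded_clinear_minus A bounded_clinear_scaleC_fun bounded_clinear_id)

lemma shift_cspan_insert:
  assumes "A x - \<mu> *\<^sub>C x \<in> cspan S" "\<And>v. v \<in> cspan S \<Longrightarrow> A v - \<mu> *\<^sub>C v \<in> cspan S"
    and "v \<in> cspan (insert x S)"
  shows "A v - \<mu> *\<^sub>C v \<in> cspan S"
proof -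
  obtain k where "v - k *\<^sub>C x \<in> cspan S" using assms(3) by (auto simp: complex_vector.span_insert)
  then have "(A (v - k *\<^sub>C x) - \<mu> *\<^sub>C (v - k *\<^sub>C x)) + k *\<^sub>C (A x - \<mu> *\<^sub>C x) \<in> cspan S"
    using assms(1,2) by (intro complex_vector.span_add complex_vector.span_scale)
  moreover have "(A (v - k *\<^sub>C x) - \<mu> *\<^sub>C (v - k *\<^sub>C x)) + k *\<^sub>C (A x - \<mu> *\<^sub>C x) = A v - \<mu> *\<^sub>C v"
    by (simp only: bounded_clinear_diff[OF bounded_clinear_shift]
        bounded_clinear_scaleC[OF bounded_clinear_shift] diff_add_cancel)
  ultimately show ?thesis by simp
qed

lemma triangular_invariant:
  "triangular A \<mu> xs \<Longrightarrow> v \<in> cspan (set xs) \<Longrightarrow> A v - \<mu> *\<^sub>C v \<in> cspan (set xs)"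
proof (induction arbitrary: v rule: triangular.induct)
  case Nil
  then show ?case by (simp add: complex_vector.span_empty bounded_clinear_zero[OF A])
next
  case (Cons xs x)
  have "A v - \<mu> *\<^sub>C v \<in> cspan (set xs)"
    using shift_cspan_insert[OF Cons.hyps(4) Cons.IH] Cons.prems by simp
  then show ?case using complex_vector.span_mono[of "set xs" "set (x # xs)"] by auto
qed

lemma triangular_nilpotent:
  "triangular A \<mu> xs \<Longrightarrow> v \<in> cspan (set xs) \<Longrightarrow> ((\<lambda>y. A y - \<mu> *\<^sub>C y) ^^ length xs) v = 0"
proof (induction arbitrary: v rule: triangular.induct)
  case Nil
  then show ?case by (simp add: complex_vector.span_empty)
next
  case (Cons xs x)
  have "A v - \<mu> *\<^sub>C v \<in> cspan (set xs)"
    using shift_cspan_insert[OF Cons.hyps(4) triangular_invariant[OF Cons.hyps(1)]] Cons.prems by simp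
  from Cons.IH[OF this] show ?case by (simp only: length_Cons funpow_Suc_right comp_apply)
qed

lemma triangular_diagonal: "triangular A \<mu> xs \<Longrightarrow> x \<in> set xs \<Longrightarrow> cinner x (A x) = \<mu>"
proof (induction rule: triangular.induct)
  case (Cons xs y)
  have "cinner y (A y - \<mu> *\<^sub>C y) = 0" using Cons.hyps(3,4) by (rule orthogonal_cspan_right)
  then have "cinner y (A y) = \<mu>"
    using Cons.hyps(2) by (simp add: cinner_diff_right cinner_scaleC_right cinner_self)
  then show ?case using Cons by auto
qed simp

text \<open>
  If \<open>A x = \<mu> x + w\<close> with \<open>w\<close> in the span of the later vectors, then \<open>x = (1 + s\<mu>) C x + s C w\<close>; so
  the inverse \<open>C\<close> of \<open>1 + sA\<close> is triangular in the same basis, with the reciprocals on the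
  diagonal.
\<close>

lemma triangular_inverse:
  assumes C: "bounded_clinear C" "\<And>x. C (x + s *\<^sub>C A x) = x" and nz: "1 + s * \<mu> \<noteq> 0"
  shows "triangular A \<mu> xs \<Longrightarrow> (\<forall>v\<in>cspan (set xs). C v \<in> cspan (set xs)) \<and>
    (\<forall>x\<in>set xs. cinner x (C x) = 1 / (1 + s * \<mu>))"
proof (induction rule: triangular.induct)
  case Nil
  then show ?case by (simp add: complex_vector.span_empty bounded_clinear_zero[OF C(1)])
next
  case (Cons xs x)
  define w where "w = A x - \<mu> *\<^sub>C x"
  have w: "w \<in> cspan (set xs)" using Cons.hyps(4) by (simp add: w_def)
  then have Cw: "C w \<in> cspan (set xs)" using Cons.IH by blast
  have "x + s *\<^sub>C A x = (1 + s * \<mu>) *\<^sub>C x + s *\<^sub>C w"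
    by (simp add: w_def complex_vector.scale_right_diff_distrib scaleC_add_left scaleC_scaleC scaleC_one)
  then have "x = (1 + s * \<mu>) *\<^sub>C C x + s *\<^sub>C C w"
    using C(2)[of x] by (simp add: bounded_clinear_add[OF C(1)] bounded_clinear_scaleC[OF C(1)])
  then have "x - s *\<^sub>C C w = (1 + s * \<mu>) *\<^sub>C C x" by (metis add_diff_cancel_right')
  then have Cx: "C x = (1 / (1 + s * \<mu>)) *\<^sub>C (x - s *\<^sub>C C w)"
    using nz by (simp add: scaleC_scaleC scaleC_one)
  have mono: "cspan (set xs) \<subseteq> cspan (set (x # xs))" by (rule complex_vector.span_mono) auto
  have "C x \<in> cspan (set (x # xs))"
    unfolding Cx
    by (rule complex_vector.span_scale[OF complex_vector.span_diff[OF complex_vector.span_base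
          complex_vector.span_scale[OF subsetD[OF mono Cw]]]]) simp
  moreover have "\<forall>v\<in>set xs. C v \<in> cspan (set (x # xs))"
    using Cons.IH mono complex_vector.span_base by blast
  moreover have "csubspace {v. C v \<in> cspan (set (x # xs))}"
    by (rule complex_vector.subspaceI)
       (simp_all add: bounded_clinear_zero[OF C(1)] bounded_clinear_add[OF C(1)] bounded_clinear_scaleC[OF C(1)]
          complex_vector.span_zero complex_vector.span_add complex_vector.span_scale)
  ultimately have "cspan (set (x # xs)) \<subseteq> {v. C v \<in> cspan (set (x # xs))}"
    by (intro complex_vector.span_minimal) auto
  moreover have "cinner x (C w) = 0" using Cons.hyps(3) Cw by (rule orthogonal_cspan_right)
  then have "cinner x (C x) = 1 / (1 + s * \<mu>)"
    unfolding Cx using Cons.hyps(2) by (simp add: cinner_scaleC_right cinner_diff_right cinner_self)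
  ultimately show ?case using Cons.IH by auto
qed

text \<open>
  The diagonal entries \<open>\<langle>x, A x\<rangle> = \<mu>\<close> at the members of the list are bounded in total by the trace
  norm. This replaces the compactness argument for finite-dimensional root spaces.
\<close>

lemma triangular_length_le:
  assumes "A = (\<lambda>x. Y (V x))" "trace_bounded V c" "bounded_clinear Y" "triangular A \<mu> xs"
  shows "real (length xs) * cmod \<mu> \<le> c * onorm Y"
proof -
  have on: "orthonormal (set xs)" "distinct xs" using triangular_orthonormal[OF assms(4)] by auto
  have "real (length xs) * cmod \<mu> = (\<Sum>e\<in>set xs. cmod (cinner e (A e)))"
    using triangular_diagonal[OF assms(4)] on(2) by (simp add: distinct_card)
  also have "\<dots> \<le> c * onorm Y"
    using assms(1-3) on(1) unfolding trace_bounded_def by blast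
  finally show ?thesis .
qed

text \<open>
  A vector outside the span of the list that \<open>A - \<mu>\<close> maps into the span could be orthogonalised
  against the list and prepended to it.
\<close>

lemma maximal_triangular_root_space:
  assumes tri: "triangular A \<mu> xs" and max: "\<And>x. \<not> triangular A \<mu> (x # xs)"
  shows "root_space A \<mu> = cspan (set xs)"
proof
  show "cspan (set xs) \<subseteq> root_space A \<mu>"
    using triangular_nilpotent[OF tri] by (auto simp: root_space_def)
  have "v \<in> cspan (set xs)" if "((\<lambda>y. A y - \<mu> *\<^sub>C y) ^^ n) v = 0" for n v
    using that
  proof (induction n arbitrary: v)
    case 0
    then show ?case by (simp add: complex_vector.span_zero)
  next
    case (Suc n)
    have Nv: "A v - \<mu> *\<^sub>C v \<in> cspan (set xs)"
      by (rule Suc.IH) (use Suc.prems in \<open>simp only: funpow_Suc_right comp_apply\<close>)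
    show ?case
    proof (rule ccontr)
      assume "v \<notin> cspan (set xs)"
      then obtain e k where e: "norm e = 1" "\<And>f. f \<in> set xs \<Longrightarrow> cinner f e = 0"
          "e = k *\<^sub>C (v - proj_on (set xs) v)"
        using orthonormal_extend[of "set xs" v] triangular_orthonormal[OF tri] by (metis finite_set)
      have "A e - \<mu> *\<^sub>C e = k *\<^sub>C ((A v - \<mu> *\<^sub>C v)
          - (A (proj_on (set xs) v) - \<mu> *\<^sub>C proj_on (set xs) v))"
        unfolding e(3) by (simp only: bounded_clinear_diff[OF bounded_clinear_shift]
            bounded_clinear_scaleC[OF bounded_clinear_shift])
      also have "\<dots> \<in> cspan (set xs)"
        by (intro complex_vector.span_scale complex_vector.span_diff Nv
            triangular_invariant[OF tri] proj_on_in_cspan)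
      finally have "triangular A \<mu> (e # xs)" using tri e(1,2) by (intro triangular.Cons)
      then show False using max by blast
    qed
  qed
  then show "root_space A \<mu> \<subseteq> cspan (set xs)" by (auto simp: root_space_def)
qed

end

text \<open>
  The length bound provides a longest triangular list, and a longest one cannot be extended.
\<close>

lemma root_space_triangular_basis:
  assumes V: "bounded_clinear V" "trace_bounded V c" and Y: "bounded_clinear Y" and \<mu>: "\<mu> \<noteq> 0"
  obtains xs where "triangular (\<lambda>x. Y (V x)) \<mu> xs" "root_space (\<lambda>x. Y (V x)) \<mu> = cspan (set xs)"
    "algebraic_multiplicity (\<lambda>x. Y (V x)) \<mu> = length xs"
proof -
  let ?A = "\<lambda>x. Y (V x)"
  have A: "bounded_clinear ?A" using Y V(1) by (rule bounded_clinear_compose)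
  have len: "length xs < Suc (nat \<lfloor>c * onorm Y / cmod \<mu>\<rfloor>)" if "triangular ?A \<mu> xs" for xs
  proof -
    have "real (length xs) \<le> c * onorm Y / cmod \<mu>"
      using triangular_length_le[OF A refl V(2) Y that] \<mu> by (simp add: field_simps)
    then show ?thesis by linarith
  qed
  obtain xs where xs: "triangular ?A \<mu> xs" "\<And>ys. triangular ?A \<mu> ys \<Longrightarrow> length ys \<le> length xs"
    using ex_has_greatest_nat[of "triangular ?A \<mu>" "[]" length "Suc (nat \<lfloor>c * onorm Y / cmod \<mu>\<rfloor>)"]
      triangular.Nil len less_imp_le by blast
  have "\<not> triangular ?A \<mu> (x # xs)" for x using xs(2)[of "x # xs"] by auto
  then have rs: "root_space ?A \<mu> = cspan (set xs)" by (rule maximal_triangular_root_space[OF A xs(1)])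
  have on: "orthonormal (set xs)" "distinct xs" using triangular_orthonormal[OF xs(1)] by auto
  have "algebraic_multiplicity ?A \<mu> = cdim (cspan (set xs))"
    unfolding algebraic_multiplicity_def rs[symmetric] root_space_def ..
  also have "\<dots> = length xs"
    using complex_vector.dim_span_eq_card_independent[OF orthonormal_independent[OF _ on(1)]] on(2)
    by (simp add: distinct_card)
  finally show ?thesis using that xs(1) rs by blast
qed

section \<open>The logarithmic derivative of the Fredholm determinant\<close>

text \<open>
  \<open>Tr((1 + sA)\<^sup>-\<^sup>1 A)\<close>, the logarithmic derivative of \<open>det(1 + sA)\<close>.
\<close>

definition fredholm_trace :: "('h :: chilbert_space \<Rightarrow> 'h) \<Rightarrow> complex \<Rightarrow> complex"
  where "fredholm_trace A s = trace_op (\<lambda>x. inv (\<lambda>x. x + s *\<^sub>C A x) (A x))"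

lemma inv_bounded_inverse: "bounded_inverse T B \<Longrightarrow> inv T = B"
  by (rule inv_equality) (simp_all add: bounded_inverse_def)

context
  fixes V :: "'h :: chilbert_space \<Rightarrow> 'h" and c :: real
  assumes V: "trace_bounded V c" "finite_rank_limit V" and ex_onb: "\<exists>B :: 'h set. is_onb B"
begin

lemma bounded_clinear_V: "bounded_clinear V"
  using V(2) by (simp add: finite_rank_limit_def)

lemma exists_bounded_inverse:
  assumes Y: "bounded_clinear Y" and inj: "\<And>x. x + s *\<^sub>C Y (V x) = 0 \<Longrightarrow> x = 0"
  shows "\<exists>B. bounded_inverse (\<lambda>x. x + s *\<^sub>C Y (V x)) B"
  using finite_rank_limit_compose[OF bounded_clinear_scaleC_fun[OF Y] V(2), of s] inj
  by (rule fredholm_alternative)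

text \<open>
  Near \<open>s\<^sub>0\<close> the inverses \<open>W s\<close> of \<open>1 + sA\<close> exist with uniformly bounded norm. The resolvent identity
  \<open>W s' = W s - (s' - s) W s' A W s\<close> expresses each difference quotient of
  \<open>s \<mapsto> Tr(W s X V)\<close> as minus a function of the same kind, with \<open>A W s X\<close> in place of \<open>X\<close>; so
  continuity of all these functions gives differentiability of all of them.
\<close>

lemma fredholm_trace_holomorphic:
  assumes Y: "bounded_clinear Y" and inj: "\<And>x. x + s0 *\<^sub>C Y (V x) = 0 \<Longrightarrow> x = 0"
  shows "\<exists>r>0. (\<forall>s\<in>ball s0 r. \<exists>B. bounded_inverse (\<lambda>x. x + s *\<^sub>C Y (V x)) B) \<and>
    fredholm_trace (\<lambda>x. Y (V x)) holomorphic_on ball s0 r"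
proof -
  define A where "A x = Y (V x)" for x
  have A: "bounded_clinear A" unfolding A_def[abs_def] using Y bounded_clinear_V by (rule bounded_clinear_compose)
  obtain B0 where B0: "bounded_inverse (\<lambda>x. x + s0 *\<^sub>C A x) B0"
    using exists_bounded_inverse[OF Y inj] by (auto simp: A_def)
  define a where "a = onorm A"
  define b where "b = onorm B0"
  have ann: "0 \<le> a" unfolding a_def using A by (rule bounded_clinear_onorm_nonneg)
  have bnn: "0 \<le> b" unfolding b_def using B0 by (intro bounded_clinear_onorm_nonneg) (simp add: bounded_inverse_def)
  \<comment> \<open>on this ball \<open>(s - s0) A B0\<close> has norm at most \<open>1/2\<close>; the summand \<open>1\<close> avoids division by \<open>0\<close>\<close>
  define r where "r = 1 / (2 * (a * b + 1))"
  have r: "0 < r" using ann bnn by (simp add: r_def add_nonneg_pos)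
  have "\<exists>W. bounded_inverse (\<lambda>x. x + s *\<^sub>C A x) W \<and> onorm W \<le> 2 * b" if s: "s \<in> ball s0 r" for s
  proof -
    have P: "bounded_clinear (\<lambda>x. (s - s0) *\<^sub>C A x)" using A by (rule bounded_clinear_scaleC_fun)
    have "norm ((s - s0) *\<^sub>C A x) \<le> cmod (s - s0) * a * norm x" for x
      using mult_left_mono[OF bounded_clinear_norm_le[OF A, of x] norm_ge_zero[of "s - s0"]]
      by (simp add: norm_scaleC a_def mult_ac)
    then have "onorm (\<lambda>x. (s - s0) *\<^sub>C A x) \<le> cmod (s - s0) * a"
      using ann by (intro onorm_bound) auto
    then have "onorm (\<lambda>x. (s - s0) *\<^sub>C A x) * b \<le> (cmod (s - s0) * a) * b"
      using bnn by (rule mult_right_mono)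
    also have "\<dots> \<le> r * (a * b)"
      using s ann bnn by (simp add: mult.assoc mult_right_mono dist_norm norm_minus_commute)
    also have "\<dots> \<le> 1 / 2"
    proof -
      have "a * b + 1 \<noteq> 0" using mult_nonneg_nonneg[OF ann bnn] by linarith
      then have "2 * (a * b + 1) * r = 1" by (simp add: r_def)
      then have "r * (a * b) = 1 / 2 - r" by (simp add: algebra_simps)
      then show ?thesis using r by simp
    qed
    finally have small: "onorm (\<lambda>x. (s - s0) *\<^sub>C A x) * b \<le> 1 / 2" .
    obtain W where W: "bounded_inverse (\<lambda>x. x + s0 *\<^sub>C A x + (s - s0) *\<^sub>C A x) W"
        "onorm W \<le> b / (1 - onorm (\<lambda>x. (s - s0) *\<^sub>C A x) * b)"
      using bounded_inverse_perturbation[OF B0 P] small by (auto simp: b_def)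
    have "(\<lambda>x. x + s0 *\<^sub>C A x + (s - s0) *\<^sub>C A x) = (\<lambda>x. x + s *\<^sub>C A x)"
      by (simp add: add.assoc flip: scaleC_add_left)
    moreover have "b / (1 - onorm (\<lambda>x. (s - s0) *\<^sub>C A x) * b) \<le> b / (1 / 2)"
      using small bnn by (intro divide_left_mono) auto
    ultimately show ?thesis using W by auto
  qed
  then obtain W where W: "\<And>s. s \<in> ball s0 r \<Longrightarrow> bounded_inverse (\<lambda>x. x + s *\<^sub>C A x) (W s)"
      and Wb: "\<And>s. s \<in> ball s0 r \<Longrightarrow> onorm (W s) \<le> 2 * b"
    by metis
  have Wcl: "bounded_clinear (W s)" if "s \<in> ball s0 r" for s
    using W[OF that] by (simp add: bounded_inverse_def)
  define t where "t X s = trace_op (\<lambda>x. W s (X (V x)))" for X s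
  \<comment> \<open>the resolvent identity, under the trace\<close>
  have ident: "t X s' = t X s - (s' - s) * t (\<lambda>x. A (W s (X x))) s'"
    if s: "s \<in> ball s0 r" and s': "s' \<in> ball s0 r" and X: "bounded_clinear X" for X s s'
  proof -
    have "W s' x = 1 *\<^sub>C W s x + (- (s' - s)) *\<^sub>C W s' (A (W s x))" for x
    proof -
      have "x = W s x + s *\<^sub>C A (W s x)" using W[OF s] by (simp add: bounded_inverse_def)
      also have "\<dots> = (W s x + s' *\<^sub>C A (W s x)) + (- (s' - s)) *\<^sub>C A (W s x)"
        by (simp add: add.assoc flip: scaleC_add_left)
      finally have "W s' x = W s' ((W s x + s' *\<^sub>C A (W s x)) + (- (s' - s)) *\<^sub>C A (W s x))" by simp
      also have "\<dots> = W s' (W s x + s' *\<^sub>C A (W s x)) + (- (s' - s)) *\<^sub>C W s' (A (W s x))"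
        by (simp only: bounded_clinear_add[OF Wcl[OF s']] bounded_clinear_scaleC[OF Wcl[OF s']])
      also have "W s' (W s x + s' *\<^sub>C A (W s x)) = W s x" using W[OF s'] by (simp add: bounded_inverse_def)
      finally show ?thesis by (simp add: scaleC_one)
    qed
    then have "t X s' = trace_op (\<lambda>x. 1 *\<^sub>C W s (X (V x)) + (- (s' - s)) *\<^sub>C W s' (A (W s (X (V x)))))"
      unfolding t_def by metis
    also have "\<dots> = 1 * t X s + (- (s' - s)) * t (\<lambda>x. A (W s (X x))) s'"
      unfolding t_def
      by (intro trace_linear[OF V(1) ex_onb, of "\<lambda>x. W s (X x)" "\<lambda>x. W s' (A (W s (X x)))"]
          bounded_clinear_compose[OF Wcl[OF s]] bounded_clinear_compose[OF Wcl[OF s']] bounded_clinear_compose[OF A] X)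
    finally show ?thesis by (simp add: algebra_simps)
  qed
  have bound: "cmod (t X s) \<le> c * (2 * b * onorm X)" if s: "s \<in> ball s0 r" and X: "bounded_clinear X" for X s
  proof -
    have "cmod (t X s) \<le> c * onorm (\<lambda>x. W s (X x))"
      unfolding t_def by (rule cmod_trace_le[OF V(1) ex_onb bounded_clinear_compose[OF Wcl[OF s] X]])
    also have "onorm (\<lambda>x. W s (X x)) \<le> 2 * b * onorm X"
      using onorm_compose_le[OF Wcl[OF s] X]
        mult_right_mono[OF Wb[OF s] bounded_clinear_onorm_nonneg[OF X]] by linarith
    finally show ?thesis using V(1) by (simp add: trace_bounded_def mult_left_mono)
  qed
  have cont: "(t X \<longlongrightarrow> t X s) (at s)" if s: "s \<in> ball s0 r" and X: "bounded_clinear X" for X s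
  proof -
    have X': "bounded_clinear (\<lambda>x. A (W s (X x)))"
      by (intro bounded_clinear_compose[OF A] bounded_clinear_compose[OF Wcl[OF s]] X)
    have "((\<lambda>s'. t X s' - t X s) \<longlongrightarrow> 0) (at s)"
    proof (rule Lim_null_comparison)
      have "cmod (t X s' - t X s) \<le> cmod (s' - s) * (c * (2 * b * onorm (\<lambda>x. A (W s (X x)))))"
        if "s' \<in> ball s0 r" for s'
        unfolding ident[OF s that X] using bound[OF that X']
        by (simp add: norm_mult mult_left_mono)
      then show "\<forall>\<^sub>F s' in at s. cmod (t X s' - t X s) \<le> cmod (s' - s) * (c * (2 * b * onorm (\<lambda>x. A (W s (X x)))))"
        using eventually_at_in_open'[OF open_ball s] by (auto elim: eventually_mono)
      show "((\<lambda>s'. cmod (s' - s) * (c * (2 * b * onorm (\<lambda>x. A (W s (X x)))))) \<longlongrightarrow> 0) (at s)"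
        by (rule tendsto_eq_intros | simp)+
    qed
    then show ?thesis by (simp add: Lim_null[of "t X"])
  qed
  have deriv: "(t X has_field_derivative - t (\<lambda>x. A (W s (X x))) s) (at s)"
    if s: "s \<in> ball s0 r" and X: "bounded_clinear X" for X s
    unfolding has_field_derivative_iff
  proof (rule Lim_transform_within_open)
    have "bounded_clinear (\<lambda>x. A (W s (X x)))"
      by (intro bounded_clinear_compose[OF A] bounded_clinear_compose[OF Wcl[OF s]] X)
    from cont[OF s this]
    show "((\<lambda>s'. - t (\<lambda>x. A (W s (X x))) s') \<longlongrightarrow> - t (\<lambda>x. A (W s (X x))) s) (at s)"
      by (rule tendsto_minus)
    show "- t (\<lambda>x. A (W s (X x))) s' = (t X s' - t X s) / (s' - s)" if "s' \<in> ball s0 r" "s' \<noteq> s" for s'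
      using ident[OF s that(1) X] that(2) by simp
  qed (use s in auto)
  have "t Y field_differentiable at s within ball s0 r" if "s \<in> ball s0 r" for s
    using has_field_derivative_at_within[OF deriv[OF that Y]] unfolding field_differentiable_def by blast
  then have "t Y holomorphic_on ball s0 r" unfolding holomorphic_on_def by blast
  moreover have "t Y s = fredholm_trace A s" if "s \<in> ball s0 r" for s
    unfolding fredholm_trace_def t_def inv_bounded_inverse[OF W[OF that]] by (simp add: A_def)
  ultimately have "fredholm_trace A holomorphic_on ball s0 r"
    by (rule holomorphic_transform)
  then show ?thesis using r W unfolding A_def[abs_def] by blast
qed

text \<open>
  The block triangular decomposition of \<open>1 + sA\<close> with respect to the root space of \<open>A\<close> at
  \<open>-1/s\<^sub>0\<close> and its orthogonal complement. The root space yields the polar part and the complement the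
  holomorphic remainder \<open>h\<close>. If \<open>-1/s\<^sub>0\<close> is not an eigenvalue, the root space is \<open>0\<close> and the polar
  part vanishes.
\<close>

lemma fredholm_trace_polar_part:
  assumes Y: "bounded_clinear Y" and s0: "s0 \<noteq> 0"
  shows "\<exists>r>0. \<exists>h. h holomorphic_on ball s0 r \<and> (\<forall>s\<in>ball s0 r - {s0}. fredholm_trace (\<lambda>x. Y (V x)) s =
    of_nat (algebraic_multiplicity (\<lambda>x. Y (V x)) (- inverse s0)) / (s - s0) + h s)"
proof -
  define \<mu> where "\<mu> = - inverse s0"
  have \<mu>: "\<mu> \<noteq> 0" "s0 * \<mu> = - 1" using s0 by (auto simp: \<mu>_def)
  define A where "A x = Y (V x)" for x
  have A_eq: "A = (\<lambda>x. Y (V x))" by (simp add: A_def[abs_def])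
  have A: "bounded_clinear A" unfolding A_eq using Y bounded_clinear_V by (rule bounded_clinear_compose)
  obtain xs where xs: "triangular A \<mu> xs" "root_space A \<mu> = cspan (set xs)"
      "algebraic_multiplicity A \<mu> = length xs"
    using root_space_triangular_basis[OF bounded_clinear_V V(1) Y \<mu>(1)] unfolding A_eq .
  define E where "E = set xs"
  have E: "finite E" "orthonormal E" and card: "card E = length xs"
    using triangular_orthonormal[OF xs(1)] by (auto simp: E_def distinct_card)
  define Q where "Q = proj_on E"
  have Q: "bounded_clinear Q" unfolding Q_def by (rule bounded_clinear_proj_on)
  have Q_span: "Q v \<in> cspan E" for v unfolding Q_def by (rule proj_on_in_cspan)
  have Q_fix: "Q v = v" if "v \<in> cspan E" for v unfolding Q_def using E that by (rule proj_on_cspan)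
  have inv: "A v \<in> cspan E" if "v \<in> cspan E" for v
  proof -
    have "(A v - \<mu> *\<^sub>C v) + \<mu> *\<^sub>C v \<in> cspan E"
      using triangular_invariant[OF A xs(1)] that unfolding E_def
      by (intro complex_vector.span_add complex_vector.span_scale)
    then show ?thesis by simp
  qed
  define Y2 where "Y2 x = Y x - Q (Y x)" for x
  have Y2: "bounded_clinear Y2" unfolding Y2_def[abs_def]
    by (intro bounded_clinear_minus Y bounded_clinear_compose[OF Q])
  define A2 where "A2 x = Y2 (V x)" for x
  have A2_def': "A2 x = A x - Q (A x)" for x by (simp add: A2_def Y2_def A_def)
  have A2: "bounded_clinear A2" unfolding A2_def[abs_def] using Y2 bounded_clinear_V by (rule bounded_clinear_compose)
  \<comment> \<open>\<open>A2\<close> vanishes on the root space, by invariance\<close>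
  have A2_Q: "A2 (x - Q x) = A2 x" for x
  proof -
    have "A2 (Q x) = 0" unfolding A2_def' using Q_fix[OF inv[OF Q_span]] by simp
    then show ?thesis by (simp add: bounded_clinear_diff[OF A2])
  qed
  \<comment> \<open>\<open>1 - Q\<close> intertwines \<open>1 + sA\<close> with \<open>1 + sA2\<close>\<close>
  have compress: "(x + s *\<^sub>C A x) - Q (x + s *\<^sub>C A x) = (x - Q x) + s *\<^sub>C A2 (x - Q x)" for s x
    unfolding A2_Q by (simp add: A2_def' bounded_clinear_add[OF Q] bounded_clinear_scaleC[OF Q]
        complex_vector.scale_right_diff_distrib)
  \<comment> \<open>such an \<open>x\<close> is orthogonal to the root space and belongs to it\<close>
  have "x = 0" if x: "x + s0 *\<^sub>C A2 x = 0" for x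
  proof -
    have "Q (A2 x) = 0" unfolding A2_def' by (simp add: bounded_clinear_diff[OF Q] Q_fix[OF Q_span])
    then have "Q x = 0"
      using x bounded_clinear_add[OF Q, of x "s0 *\<^sub>C A2 x"]
      by (simp add: bounded_clinear_scaleC[OF Q] bounded_clinear_zero[OF Q])
    have "\<mu> *\<^sub>C (x + s0 *\<^sub>C A2 x) = 0" using x by simp
    then have "A2 x = \<mu> *\<^sub>C x"
      using \<mu>(2) by (simp add: scaleC_add_right scaleC_scaleC mult.commute complex_vector.scale_minus_left scaleC_one)
    then have "A x - \<mu> *\<^sub>C x = Q (A x)" unfolding A2_def' by (simp add: algebra_simps)
    then have "A x - \<mu> *\<^sub>C x \<in> root_space A \<mu>" using Q_span xs(2) by (simp add: E_def)
    then obtain n where "((\<lambda>y. A y - \<mu> *\<^sub>C y) ^^ n) (A x - \<mu> *\<^sub>C x) = 0" by (auto simp: root_space_def)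
    then have "((\<lambda>y. A y - \<mu> *\<^sub>C y) ^^ Suc n) x = 0" by (simp only: funpow_Suc_right comp_apply)
    then have "x \<in> cspan E" unfolding E_def xs(2)[symmetric] root_space_def by blast
    then show "x = 0" using \<open>Q x = 0\<close> Q_fix by simp
  qed
  then have inj2: "x + s0 *\<^sub>C Y2 (V x) = 0 \<Longrightarrow> x = 0" for x unfolding A2_def by blast
  obtain r where r: "0 < r" "\<And>s. s \<in> ball s0 r \<Longrightarrow> \<exists>B. bounded_inverse (\<lambda>x. x + s *\<^sub>C A2 x) B"
      "fredholm_trace A2 holomorphic_on ball s0 r"
  proof -
    have A2_eq: "A2 = (\<lambda>x. Y2 (V x))" by (simp add: A2_def[abs_def])
    show thesis
      using fredholm_trace_holomorphic[OF Y2 inj2, folded A2_def] that unfolding A2_eq by blast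
  qed
  \<comment> \<open>the second bound keeps \<open>s\<close> away from \<open>0\<close>\<close>
  define r' where "r' = min r (cmod s0)"
  have "fredholm_trace A s = of_nat (algebraic_multiplicity A \<mu>) / (s - s0) + fredholm_trace A2 s"
    if s: "s \<in> ball s0 r' - {s0}" for s
  proof -
    have "s \<noteq> 0" "s \<in> ball s0 r" "s \<noteq> s0" using s by (auto simp: r'_def)
    have ne: "1 + s * \<mu> \<noteq> 0" using \<open>s \<noteq> s0\<close> s0 by (simp add: \<mu>_def field_simps)
    obtain W where W: "bounded_inverse (\<lambda>x. x + s *\<^sub>C A2 x) W" using r(2)[OF \<open>s \<in> ball s0 r\<close>] by blast
    have Wcl: "bounded_clinear W" using W by (simp add: bounded_inverse_def)
    have "x = 0" if x: "x + s *\<^sub>C A x = 0" for x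
    proof -
      have "(x - Q x) + s *\<^sub>C A2 (x - Q x) = 0"
        unfolding compress[symmetric] x by (simp add: bounded_clinear_zero[OF Q])
      moreover have "W ((x - Q x) + s *\<^sub>C A2 (x - Q x)) = x - Q x" using W unfolding bounded_inverse_def by blast
      ultimately have "x = Q x" by (simp add: bounded_clinear_zero[OF Wcl])
      then have "x \<in> cspan E" using Q_span[of x] by simp
      then have zero: "((\<lambda>y. A y - \<mu> *\<^sub>C y) ^^ length xs) x = 0"
        using triangular_nilpotent[OF A xs(1)] by (simp add: E_def)
      have "(1 / s) *\<^sub>C (x + s *\<^sub>C A x) = 0" using x by simp
      then have "A x = - (1 / s) *\<^sub>C x"
        using \<open>s \<noteq> 0\<close> by (simp add: scaleC_add_right scaleC_scaleC scaleC_one eq_neg_iff_add_eq_0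
            complex_vector.scale_minus_left add.commute)
      then have eig: "A x - \<mu> *\<^sub>C x = (- (1 / s) - \<mu>) *\<^sub>C x"
        by (simp only: complex_vector.scale_left_diff_distrib)
      \<comment> \<open>\<open>x\<close> would be an eigenvector for \<open>- 1 / s\<close>, but \<open>A - \<mu>\<close> is nilpotent on the root space\<close>
      have "((\<lambda>y. A y - \<mu> *\<^sub>C y) ^^ n) x = (- (1 / s) - \<mu>) ^ n *\<^sub>C x" for n
      proof (induction n)
        case (Suc n)
        have "((\<lambda>y. A y - \<mu> *\<^sub>C y) ^^ Suc n) x = (- (1 / s) - \<mu>) ^ n *\<^sub>C (A x - \<mu> *\<^sub>C x)"
          unfolding funpow.simps comp_apply Suc by (rule bounded_clinear_scaleC[OF bounded_clinear_shift[OF A]])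
        then show ?case by (simp only: eig scaleC_scaleC power_Suc2)
      qed (simp add: scaleC_one)
      moreover have "- (1 / s) - \<mu> \<noteq> 0" using ne \<open>s \<noteq> 0\<close> by (simp add: field_simps add_eq_0_iff)
      ultimately show "x = 0" using zero by simp
    qed
    then have inj: "x + s *\<^sub>C Y (V x) = 0 \<Longrightarrow> x = 0" for x unfolding A_def by blast
    obtain C where C: "bounded_inverse (\<lambda>x. x + s *\<^sub>C A x) C"
      using exists_bounded_inverse[OF Y inj] by (auto simp: A_def)
    have Ccl: "bounded_clinear C" and Cleft: "\<And>x. C (x + s *\<^sub>C A x) = x" and Cright: "\<And>x. C x + s *\<^sub>C A (C x) = x"
      using C by (auto simp: bounded_inverse_def)
    have split: "C (A x) = 1 *\<^sub>C W (Y2 (V x)) + 1 *\<^sub>C Q (C (A x))" for x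
    proof -
      have "(C (A x) - Q (C (A x))) + s *\<^sub>C A2 (C (A x) - Q (C (A x))) = A2 x"
        using compress[of "C (A x)" s] by (simp only: Cright A2_def'[of x])
      then have "C (A x) - Q (C (A x)) = W (A2 x)" using W unfolding bounded_inverse_def by metis
      then show ?thesis by (simp add: scaleC_one A2_def algebra_simps)
    qed
    have "fredholm_trace A s = trace_op (\<lambda>x. C (A x))"
      unfolding fredholm_trace_def inv_bounded_inverse[OF C] ..
    also have "\<dots> = trace_op (\<lambda>x. 1 *\<^sub>C W (Y2 (V x)) + 1 *\<^sub>C Q (C (Y (V x))))"
      using split by (simp add: A_def)
    also have "\<dots> = 1 * trace_op (\<lambda>x. W (Y2 (V x))) + 1 * trace_op (\<lambda>x. Q (C (Y (V x))))"
      by (intro trace_linear[OF V(1) ex_onb, of "\<lambda>x. W (Y2 x)" "\<lambda>x. Q (C (Y x))"]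
          bounded_clinear_compose[OF Wcl] bounded_clinear_compose[OF Q] bounded_clinear_compose[OF Ccl] Y Y2)
    also have "trace_op (\<lambda>x. W (Y2 (V x))) = fredholm_trace A2 s"
      unfolding fredholm_trace_def inv_bounded_inverse[OF W] by (simp add: A2_def)
    also have "trace_op (\<lambda>x. Q (C (Y (V x)))) = (\<Sum>e\<in>E. cinner e (C (A e)))"
      unfolding Q_def A_eq[symmetric, THEN fun_cong]
      by (rule trace_proj_on[OF ex_onb E(1)]) (rule bounded_clinear_compose[OF Ccl A])
    also have "\<dots> = (\<Sum>e\<in>E. 1 / (s - s0))"
    proof (rule sum.cong[OF refl])
      fix e assume e: "e \<in> E"
      have "cinner e (C e) = 1 / (1 + s * \<mu>)"
        using triangular_inverse[OF A Ccl Cleft ne xs(1)] e by (simp add: E_def)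
      moreover have "cinner e (C e + s *\<^sub>C C (A e)) = 1"
        using Cleft[of e] e E(2)
        by (simp add: bounded_clinear_add[OF Ccl] bounded_clinear_scaleC[OF Ccl] cinner_orthonormal)
      ultimately have "1 / (1 + s * \<mu>) + s * cinner e (C (A e)) = 1"
        by (simp add: cinner_add_right cinner_scaleC_right)
      then have "s * cinner e (C (A e)) = s * (\<mu> / (1 + s * \<mu>))"
        using ne by (simp add: field_simps)
      then have "cinner e (C (A e)) = \<mu> / (1 + s * \<mu>)" using \<open>s \<noteq> 0\<close> by (rule mult_left_cancel[THEN iffD1, rotated])
      also have "\<dots> = 1 / (s - s0)" using ne s0 \<open>s \<noteq> s0\<close> by (simp add: \<mu>_def field_simps)
      finally show "cinner e (C (A e)) = 1 / (s - s0)" .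
    qed
    finally show ?thesis by (simp add: card xs(3))
  qed
  moreover have "fredholm_trace A2 holomorphic_on ball s0 r'"
    using r(3) by (rule holomorphic_on_subset) (auto simp: r'_def)
  moreover have "0 < r'" using r(1) s0 by (simp add: r'_def)
  ultimately show ?thesis unfolding A_eq \<mu>_def by blast
qed

end


section \<open>Meromorphic continuation and the residue\<close>

lemma holomorphic_on_ball_imp_analytic_at:
  "0 < r \<Longrightarrow> h holomorphic_on ball s0 r \<Longrightarrow> h analytic_on {s0}"
  by (meson analytic_at centre_in_ball open_ball)

lemma residue_simple_polar_part:
  assumes "0 < r" "h holomorphic_on ball s0 r"
    and "\<And>s. s \<in> ball s0 r - {s0} \<Longrightarrow> g s = k / (s - s0) + h s"
  shows "residue g s0 = k"
proof -
  have "eventually (\<lambda>s. g s = k / (s - s0) + h s) (at s0)"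
    using eventually_at_in_open[of "ball s0 r" s0] assms(1,3) by (auto elim: eventually_mono)
  then have "residue g s0 = residue (\<lambda>s. k / (s - s0) + h s) s0" by (rule residue_cong) simp
  also have "\<dots> = residue (\<lambda>s. k / (s - s0)) s0 + residue h s0"
    using assms(1,2) by (intro residue_add[of "ball s0 r"])
      (auto intro!: holomorphic_intros intro: holomorphic_on_subset)
  also have "\<dots> = k"
    using assms(1,2) residue_simple[of "ball s0 r" s0 "\<lambda>_. k"] residue_holo[of "ball s0 r" s0 h] by simp
  finally show ?thesis .
qed

lemma simple_polar_part_meromorphic:
  assumes "0 < r" "h holomorphic_on ball s0 r"
    and "\<And>s. s \<in> ball s0 r - {s0} \<Longrightarrow> g s = k / (s - s0) + h s"
  shows "g meromorphic_on {s0}"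
proof -
  have "eventually (\<lambda>s. g s = k / (s - s0) + h s) (at s0)"
    using eventually_at_in_open[of "ball s0 r" s0] assms(1,3) by (auto elim: eventually_mono)
  moreover have "h analytic_on {s0}"
    using assms(1,2) by (rule holomorphic_on_ball_imp_analytic_at)
  then have "(\<lambda>s. k / (s - s0) + h s) meromorphic_on {s0}"
    by (intro meromorphic_intros analytic_on_imp_meromorphic_on[of h])
  ultimately show ?thesis
    using meromorphic_on_cong[of "{s0}" g "\<lambda>s. k / (s - s0) + h s" "{s0}"] by simp
qed

lemma nicely_meromorphic_eq_remove_sings:
  assumes "G nicely_meromorphic_on UNIV"
  shows "remove_sings G z = G z"
proof -
  have "(is_pole G z \<and> G z = 0) \<or> G \<midarrow>z\<rightarrow> G z"
    using assms by (simp add: nicely_meromorphic_on_def)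
  then show ?thesis by auto
qed

text \<open>
  The difference of two continuations vanishes on the real line, whose points accumulate, hence away
  from a discrete set. The values at the remaining points agree by the
  convention built into \<open>nicely_meromorphic_on\<close>.
\<close>

lemma meromorphic_continuation_eq:
  assumes mero: "g meromorphic_on UNIV"
    and real: "\<And>s. g analytic_on {complex_of_real s}" "\<And>s. g (complex_of_real s) = f s"
  shows "meromorphic_continuation f = remove_sings g"
  unfolding meromorphic_continuation_def
proof (rule the_equality)
  show g: "remove_sings g nicely_meromorphic_on UNIV \<and> (\<forall>s. remove_sings g (complex_of_real s) = f s)"
    using remove_sings_nicely_meromorphic[OF mero] real by simp
  fix G assume G: "G nicely_meromorphic_on UNIV \<and> (\<forall>s. G (complex_of_real s) = f s)"
  define D where "D s = G s - remove_sings g s" for s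
  have D: "D meromorphic_on UNIV"
    unfolding D_def[abs_def] using G g by (intro meromorphic_on_diff) (auto simp: nicely_meromorphic_on_def)
  have eq: "eventually (\<lambda>s. remove_sings D s = D s) (at z)" for z
    by (rule eventually_remove_sings_eq_at[OF meromorphic_on_isolated_singularity[OF meromorphic_on_subset[OF D]]])
       simp
  have "frequently (\<lambda>s. remove_sings D s = 0) (at 0)"
    unfolding frequently_def
  proof
    assume "eventually (\<lambda>s. remove_sings D s \<noteq> 0) (at 0)"
    with eq[of 0] have "eventually (\<lambda>s. D s \<noteq> 0) (at 0)" by eventually_elim simp
    then obtain d where d: "0 < d" "\<And>s. s \<noteq> 0 \<Longrightarrow> dist s 0 < d \<Longrightarrow> D s \<noteq> 0"
      unfolding eventually_at by blast
    have "D (complex_of_real (d / 2)) = 0" using G g unfolding D_def by (simp only: diff_self)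
    then show False using d(2)[of "complex_of_real (d / 2)"] d(1) by simp
  qed
  then have zero: "remove_sings D z = 0" for z
    by (rule frequently_eq_meromorphic_imp_constant[OF _ remove_sings_nicely_meromorphic[OF D]]) auto
  \<comment> \<open>passing from \<open>remove_sings D\<close> to \<open>D\<close> loses only isolated points\<close>
  have "eventually (\<lambda>s. G s = remove_sings g s) (at z)" for z
    using eq[of z] by eventually_elim (simp add: zero D_def)
  then have "remove_sings G z = remove_sings (remove_sings g) z" for z by (intro remove_sings_cong refl)
  then show "G = remove_sings g"
    using G g by (intro ext) (simp add: nicely_meromorphic_eq_remove_sings)
qed

lemma fredholm_trace_meromorphic:
  fixes V :: "'h :: chilbert_space \<Rightarrow> 'h"
  assumes V: "trace_bounded V c" "finite_rank_limit V" "\<exists>B :: 'h set. is_onb B" and Y: "bounded_clinear Y"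
  shows "fredholm_trace (\<lambda>x. Y (V x)) meromorphic_on UNIV"
proof (subst meromorphic_on_meromorphic_at, intro ballI)
  fix s0
  show "fredholm_trace (\<lambda>x. Y (V x)) meromorphic_on {s0}"
  proof (cases "s0 = 0")
    case True
    obtain r where "0 < r" "fredholm_trace (\<lambda>x. Y (V x)) holomorphic_on ball s0 r"
      using fredholm_trace_holomorphic[OF V Y, of s0] True by auto
    then show ?thesis by (intro analytic_on_imp_meromorphic_on holomorphic_on_ball_imp_analytic_at)
  next
    case False
    obtain r h where "0 < r" "h holomorphic_on ball s0 r" "\<And>s. s \<in> ball s0 r - {s0} \<Longrightarrow>
        fredholm_trace (\<lambda>x. Y (V x)) s =
        of_nat (algebraic_multiplicity (\<lambda>x. Y (V x)) (- inverse s0)) / (s - s0) + h s"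
      using fredholm_trace_polar_part[OF V Y False] by metis
    then show ?thesis by (rule simple_polar_part_meromorphic)
  qed
qed

lemma fredholm_trace_resolvent:
  fixes V :: "'h :: chilbert_space \<Rightarrow> 'h"
  assumes V: "trace_bounded V c" "finite_rank_limit V" "\<exists>B :: 'h set. is_onb B"
    and sym: "\<And>x y. cinner (V y) x = cinner y (V x)"
    and H: "selfadjoint_on D H" and z: "z \<notin> \<real>"
  shows "fredholm_trace (\<lambda>x. resolvent D H z (V x)) analytic_on {complex_of_real s}"
    and "fredholm_trace (\<lambda>x. resolvent D H z (V x)) (complex_of_real s) =
      trace_op (\<lambda>x. resolvent D (\<lambda>y. H y + s *\<^sub>R V y) z (V x))"
proof -
  note Vcl = bounded_clinear_V[OF V(1,2,3)]
  note R = bounded_clinear_resolvent[OF H z]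
  have inj: "x + complex_of_real s *\<^sub>C resolvent D H z (V x) = 0 \<Longrightarrow> x = 0" for x
    by (rule resolvent_perturbation_inj[OF H z Vcl sym])
  obtain r where r: "0 < r" "fredholm_trace (\<lambda>x. resolvent D H z (V x)) holomorphic_on ball (complex_of_real s) r"
    using fredholm_trace_holomorphic[OF V R inj] by auto
  then show "fredholm_trace (\<lambda>x. resolvent D H z (V x)) analytic_on {complex_of_real s}"
    by (rule holomorphic_on_ball_imp_analytic_at)
  obtain B where B: "bounded_inverse (\<lambda>x. x + complex_of_real s *\<^sub>C resolvent D H z (V x)) B"
    using exists_bounded_inverse[OF V R inj] by blast
  have "B (resolvent D H z (V x)) = resolvent D (\<lambda>y. H y + s *\<^sub>R V y) z (V x)" for x
    using B resolvent_perturbation[OF H z Vcl sym, of s "V x"] unfolding bounded_inverse_def by metis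
  then show "fredholm_trace (\<lambda>x. resolvent D H z (V x)) (complex_of_real s) =
      trace_op (\<lambda>x. resolvent D (\<lambda>y. H y + s *\<^sub>R V y) z (V x))"
    unfolding fredholm_trace_def inv_bounded_inverse[OF B] by simp
qed

lemma F_real_eq:
  fixes V :: "'h :: chilbert_space \<Rightarrow> 'h"
  assumes V: "trace_bounded V c" "finite_rank_limit V" "\<exists>B :: 'h set. is_onb B"
    and sym: "\<And>x y. cinner (V y) x = cinner y (V x)"
    and H: "selfadjoint_on D H" and z: "z \<notin> \<real>"
  shows "F_real D H V z s = 1 / (2 * complex_of_real pi * \<i>) *
    (fredholm_trace (\<lambda>x. resolvent D H z (V x)) (complex_of_real s)
      - fredholm_trace (\<lambda>x. resolvent D H (cnj z) (V x)) (complex_of_real s))"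
proof -
  have z': "cnj z \<notin> \<real>" using z by (simp add: complex_is_Real_iff)
  let ?H = "\<lambda>y. H y + s *\<^sub>R V y" and ?k = "1 / (2 * complex_of_real pi * \<i>)"
  have Hs: "selfadjoint_on D ?H"
    by (rule selfadjoint_on_perturbation[OF H bounded_clinear_V[OF V] sym])
  have "F_real D H V z s =
      trace_op (\<lambda>x. ?k *\<^sub>C resolvent D ?H z (V x) + (- ?k) *\<^sub>C resolvent D ?H (cnj z) (V x))"
    unfolding F_real_def Im_op_def cadjoint_resolvent[OF Hs z]
    by (simp add: scaleC_scaleC complex_vector.scale_right_diff_distrib complex_vector.scale_minus_left mult_ac)
  also have "\<dots> = ?k * trace_op (\<lambda>x. resolvent D ?H z (V x)) + (- ?k) * trace_op (\<lambda>x. resolvent D ?H (cnj z) (V x))"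
    by (rule trace_linear[OF V(1,3)]) (rule bounded_clinear_resolvent[OF Hs z] bounded_clinear_resolvent[OF Hs z'])+
  finally show ?thesis
    unfolding fredholm_trace_resolvent(2)[OF V sym H z] fredholm_trace_resolvent(2)[OF V sym H z']
    by (simp add: algebra_simps)
qed

theorem theorem3p3:
  fixes F :: "'h :: chilbert_space \<Rightarrow> 'k :: chilbert_space"
    and D :: "'h set" and H\<^sub>0 V :: "'h \<Rightarrow> 'h" and z s\<^sub>0 :: complex
  assumes "separable_space (euclidean :: 'h topology)"
    and "frame F"
    and "selfadjoint_on D H\<^sub>0"
    and "V \<in> frame_perturbations F"
    and "z \<notin> \<real>"
    and "is_pole (F_fun D H\<^sub>0 V z) s\<^sub>0"
  shows "s\<^sub>0 \<notin> \<real> \<and>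
    2 * complex_of_real pi * \<i> * residue (F_fun D H\<^sub>0 V z) s\<^sub>0 =
      of_nat (algebraic_multiplicity (resolvent D H\<^sub>0 z \<circ> V) (- inverse s\<^sub>0))
      - of_nat (algebraic_multiplicity (resolvent D H\<^sub>0 (cnj z) \<circ> V) (- inverse s\<^sub>0))"
proof -
  obtain J where J: "bounded_selfadjoint J" and V_eq: "V = (\<lambda>x. cadjoint F (J (F x)))"
    using assms(4) by (auto simp: frame_perturbations_def comp_def)
  have hs: "hilbert_schmidt F" using assms(2) by (simp add: frame_def)
  then have F: "bounded_clinear F" and onb: "\<exists>B :: 'h set. is_onb B"
    by (auto simp: hilbert_schmidt_def)
  have Jcl: "bounded_clinear J" and Jadj: "cadjoint J = J" using J by (auto simp: bounded_selfadjoint_def)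
  obtain c where c: "trace_bounded V c"
    unfolding V_eq using frame_perturbation_trace_bounded[OF hs Jcl] by blast
  have lim: "finite_rank_limit V" unfolding V_eq
    by (rule finite_rank_limit_compose[OF bounded_clinear_compose[OF bounded_clinear_cadjoint[OF F] Jcl]
          hilbert_schmidt_finite_rank_limit[OF hs]])
  have sym: "cinner (V y) x = cinner y (V x)" for x y
    unfolding V_eq using cinner_cadjoint_left[OF Jcl]
    by (simp add: cinner_cadjoint_left[OF F] cinner_cadjoint_right[OF F] Jadj)
  note V = c lim onb
  have z': "cnj z \<notin> \<real>" using assms(5) by (simp add: complex_is_Real_iff)
  note R = bounded_clinear_resolvent[OF assms(3,5)] and R' = bounded_clinear_resolvent[OF assms(3) z']
  define A where "A = (\<lambda>x. resolvent D H\<^sub>0 z (V x))"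
  define B where "B = (\<lambda>x. resolvent D H\<^sub>0 (cnj z) (V x))"
  define k where "k = 1 / (2 * complex_of_real pi * \<i>)"
  define g where "g = (\<lambda>s. k * (fredholm_trace A s - fredholm_trace B s))"
  have mero: "g meromorphic_on UNIV"
    unfolding g_def A_def B_def
    by (intro meromorphic_intros fredholm_trace_meromorphic[OF V R] fredholm_trace_meromorphic[OF V R'])
  have analytic: "g analytic_on {complex_of_real s}" for s
    unfolding g_def A_def B_def
    by (intro analytic_intros fredholm_trace_resolvent(1)[OF V sym assms(3,5)]
        fredholm_trace_resolvent(1)[OF V sym assms(3) z'])
  have "g (complex_of_real s) = F_real D H\<^sub>0 V z s" for s
    unfolding g_def A_def B_def k_def F_real_eq[OF V sym assms(3,5)] ..
  then have F_fun: "F_fun D H\<^sub>0 V z = remove_sings g"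
    unfolding F_fun_def using meromorphic_continuation_eq[OF mero analytic] by blast
  have isol: "isolated_singularity_at g s\<^sub>0"
    by (rule meromorphic_on_isolated_singularity[OF meromorphic_on_subset[OF mero]]) simp
  have pole: "is_pole g s\<^sub>0"
    using assms(6) is_pole_cong[OF eventually_remove_sings_eq_at[OF isol] refl] unfolding F_fun by blast
  have nonreal: "s\<^sub>0 \<notin> \<real>"
    using pole analytic analytic_at_imp_no_pole by (auto elim!: Reals_cases)
  then have "s\<^sub>0 \<noteq> 0" by auto
  let ?m = "of_nat (algebraic_multiplicity A (- inverse s\<^sub>0)) :: complex"
  let ?n = "of_nat (algebraic_multiplicity B (- inverse s\<^sub>0)) :: complex"
  obtain r h where h: "0 < r" "h holomorphic_on ball s\<^sub>0 r"
      "\<And>s. s \<in> ball s\<^sub>0 r - {s\<^sub>0} \<Longrightarrow> fredholm_trace A s = ?m / (s - s\<^sub>0) + h s"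
    unfolding A_def using fredholm_trace_polar_part[OF V R \<open>s\<^sub>0 \<noteq> 0\<close>] by metis
  obtain r' h' where h': "0 < r'" "h' holomorphic_on ball s\<^sub>0 r'"
      "\<And>s. s \<in> ball s\<^sub>0 r' - {s\<^sub>0} \<Longrightarrow> fredholm_trace B s = ?n / (s - s\<^sub>0) + h' s"
    unfolding B_def using fredholm_trace_polar_part[OF V R' \<open>s\<^sub>0 \<noteq> 0\<close>] by metis
  have "residue g s\<^sub>0 = k * (?m - ?n)"
  proof (rule residue_simple_polar_part)
    show "0 < min r r'" using h(1) h'(1) by simp
    show "(\<lambda>s. k * (h s - h' s)) holomorphic_on ball s\<^sub>0 (min r r')"
      by (intro holomorphic_intros holomorphic_on_subset[OF h(2)] holomorphic_on_subset[OF h'(2)]) auto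
    show "g s = k * (?m - ?n) / (s - s\<^sub>0) + k * (h s - h' s)" if "s \<in> ball s\<^sub>0 (min r r') - {s\<^sub>0}" for s
      using h(3)[of s] h'(3)[of s] that by (simp add: g_def algebra_simps diff_divide_distrib)
  qed
  then have "2 * complex_of_real pi * \<i> * residue (F_fun D H\<^sub>0 V z) s\<^sub>0 = ?m - ?n"
    unfolding F_fun residue_remove_sings[OF isol] by (simp add: k_def)
  then show ?thesis using nonreal by (simp add: A_def B_def comp_def)
qed

end
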